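(* (Chevalley-Monk formula) Let $n\ge 2$, let $1\le i\le n-1$, let $p_i = p_{s_i}$ denote the Schubert class in $H^*(GL_n(\mathbb{C})/B)$ corresponding to the simple reflection $s_i=(i,i+1)$, and let $p_w \in H^*(GL_n(\mathbb{C})/B)$ be the Schubert class of any $w\in S_n$. Then in $H^*(GL_n(\mathbb{C})/B)$ \[ p_i\, p_w = \sum_{\substack{(jk):\ \ell(w(jk))=\ell(w)+1 \\ j \leq i < i+1 \leq k}} p_{w(jk)},\] where the sum is over transpositions $(jk)\in S_n$ with $j<k$ satisfying the indicated conditions.
   Context: $B \subset GL_n(\mathbb{C})$ is the subgroup of invertible upper-triangular matrices and $T$ the torus of invertible diagonal matrices. $S_n$ is the group of permutations of $\{1,\dots,n\}$, with product given by composition of functions, $(uv)(k)=u(v(k))$. The length $\ell(w)$ is the minimal number of simple transpositions $s_i=(i,i+1)$ in a factorization of $w$. Equivariant cohomology is described by GKM theory: $H^*_T(GL_n(\mathbb{C})/B)$ is the ring (under pointwise operations) of tuples $p=(p(v))_{v\in S_n}$ of polynomials $p(v)\in \mathbb{C}[t_1,\dots,t_n]$ such that $p(v)-p((jk)v)$ is divisible by $t_j-t_k$ for all $v\in S_n$ and all $1\le j<k\le n$. It is an algebra over $H^*_T(pt)=\mathbb{C}[t_1,\dots,t_n]$. Ordinary cohomology is the quotient ring \[H^*(GL_n(\mathbb{C})/B) = \frac{H^*_T(GL_n(\mathbb{C})/B)}{\langle t_1,\dots,t_n\rangle H^*_T(GL_n(\mathbb{C})/B)}.\] The moment graph has vertex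 set $S_n$ and a directed edge $v\mapsto (jk)v$, labeled $t_j-t_k$ ($j<k$), whenever $\ell(v)>\ell((jk)v)$. Write $u \ge v$ if $u=v$ or there is a directed chain of edges $u\mapsto u_1\mapsto\cdots\mapsto v$ (Bruhat order). The equivariant Schubert class (canonical class) $p_w$, $w\in S_n$, is the unique element of $H^*_T(GL_n(\mathbb{C})/B)$ such that: $p_w(u)=0$ unless $u\ge w$; $p_w(w)=\prod (t_j-t_k)$, the product over all $j<k$ with $\ell((jk)w)<\ell(w)$; and every $p_w(u)$ is zero or homogeneous of polynomial degree $\ell(w)$. The classes $p_w$ form a basis of $H^*_T(GL_n(\mathbb{C})/B)$ as a free $\mathbb{C}[t_1,\dots,t_n]$-module. The Schubert class in $H^*(GL_n(\mathbb{C})/B)$, also denoted $p_w$, is the image of the equivariant one under the quotient map. *)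

theory Defs
  imports
    Complex_Main
    "HOL-Library.Poly_Mapping"
    "HOL-Combinatorics.Permutations"
    "HOL-Algebra.QuotRing"
begin

text \<open>Polynomials are finitely supported functions from exponent vectors to coefficients,
  with the convolution product; the variables are indexed by all naturals, and
  \<open>polys n\<close> is the subring of polynomials in the variables \<open>1, \<dots>, n\<close>.\<close>

type_synonym cpoly = "(nat \<Rightarrow>\<^sub>0 nat) \<Rightarrow>\<^sub>0 complex"

definition tvar :: "nat \<Rightarrow> cpoly" where
  "tvar i = Poly_Mapping.single (Poly_Mapping.single i 1) 1"

definition polys :: "nat \<Rightarrow> cpoly set" where
  "polys n = {f. \<forall>m \<in> Poly_Mapping.keys f. Poly_Mapping.keys m \<subseteq> {1..n}}"

text \<open>The zero polynomial is homogeneous of every degree.\<close>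

definition homogeneous :: "nat \<Rightarrow> cpoly \<Rightarrow> bool" where
  "homogeneous d f \<longleftrightarrow>
     (\<forall>m \<in> Poly_Mapping.keys f. (\<Sum>i \<in> Poly_Mapping.keys m. Poly_Mapping.lookup m i) = d)"

text \<open>Permutations act as the identity outside \<open>{1..n}\<close>; the product is \<open>\<circ>\<close>.\<close>

definition Sym :: "nat \<Rightarrow> (nat \<Rightarrow> nat) set" where
  "Sym n = {w. w permutes {1..n}}"

abbreviation simple_refl :: "nat \<Rightarrow> nat \<Rightarrow> nat" where
  "simple_refl i \<equiv> transpose i (i + 1)"

definition len :: "nat \<Rightarrow> (nat \<Rightarrow> nat) \<Rightarrow> nat" where
  "len n w = (LEAST m. \<exists>is. length is = m \<and> set is \<subseteq> {1..<n} \<and>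
                            w = foldr (\<lambda>i u. simple_refl i \<circ> u) is id)"

definition moment_edge :: "nat \<Rightarrow> (nat \<Rightarrow> nat) \<Rightarrow> (nat \<Rightarrow> nat) \<Rightarrow> bool" where
  "moment_edge n v u \<longleftrightarrow> v \<in> Sym n \<and>
     (\<exists>j k. 1 \<le> j \<and> j < k \<and> k \<le> n \<and> u = transpose j k \<circ> v \<and> len n u < len n v)"

definition bruhat_ge :: "nat \<Rightarrow> (nat \<Rightarrow> nat) \<Rightarrow> (nat \<Rightarrow> nat) \<Rightarrow> bool" where
  "bruhat_ge n = (moment_edge n)\<^sup>*\<^sup>*"

text \<open>GKM tuples are extensional functions (\<open>undefined\<close> outside \<open>Sym n\<close>), so
  that two tuples are equal iff they agree on \<open>Sym n\<close>.  The quotient in the divisibility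
  condition is required to lie in the polynomial ring of these \<open>n\<close> variables.\<close>

definition HT :: "nat \<Rightarrow> ((nat \<Rightarrow> nat) \<Rightarrow> cpoly) ring" where
  "HT n =
    \<lparr>carrier = {p \<in> Sym n \<rightarrow>\<^sub>E polys n.
        \<forall>v \<in> Sym n. \<forall>j k. 1 \<le> j \<and> j < k \<and> k \<le> n \<longrightarrow>
          (\<exists>q \<in> polys n. p v - p (transpose j k \<circ> v) = (tvar j - tvar k) * q)},
     mult = (\<lambda>p q. \<lambda>v\<in>Sym n. p v * q v),
     one = (\<lambda>v\<in>Sym n. 1),
     zero = (\<lambda>v\<in>Sym n. 0),
     add = (\<lambda>p q. \<lambda>v\<in>Sym n. p v + q v)\<rparr>"

text \<open>The base ring acts through constant tuples, so the submodule generated by its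
  augmentation ideal is the ideal generated by the constant tuples with value \<open>tvar i\<close>.\<close>

definition aug_ideal :: "nat \<Rightarrow> ((nat \<Rightarrow> nat) \<Rightarrow> cpoly) set" where
  "aug_ideal n = Idl\<^bsub>HT n\<^esub> ((\<lambda>i. \<lambda>v\<in>Sym n. tvar i) ` {1..n})"

definition H :: "nat \<Rightarrow> ((nat \<Rightarrow> nat) \<Rightarrow> cpoly) set ring" where
  "H n = HT n Quot aug_ideal n"

definition is_eq_schubert ::
    "nat \<Rightarrow> (nat \<Rightarrow> nat) \<Rightarrow> ((nat \<Rightarrow> nat) \<Rightarrow> cpoly) \<Rightarrow> bool" where
  "is_eq_schubert n w p \<longleftrightarrow>
     p \<in> carrier (HT n) \<and>
     (\<forall>u \<in> Sym n. \<not> bruhat_ge n u w \<longrightarrow> p u = 0) \<and>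
     p w = (\<Prod>(j, k) \<in> {(j, k). 1 \<le> j \<and> j < k \<and> k \<le> n \<and>
                                  len n (transpose j k \<circ> w) < len n w}. tvar j - tvar k) \<and>
     (\<forall>u \<in> Sym n. homogeneous (len n w) (p u))"

definition eq_schubert :: "nat \<Rightarrow> (nat \<Rightarrow> nat) \<Rightarrow> (nat \<Rightarrow> nat) \<Rightarrow> cpoly" where
  "eq_schubert n w = (THE p. is_eq_schubert n w p)"

definition schubert :: "nat \<Rightarrow> (nat \<Rightarrow> nat) \<Rightarrow> ((nat \<Rightarrow> nat) \<Rightarrow> cpoly) set" where
  "schubert n w = aug_ideal n +>\<^bsub>HT n\<^esub> eq_schubert n w"

end

(* Everything reduces to one degree principle: a class all of whose values are homogeneous of degree d
   and vanish on the permutations of length at most d is zero, because at a shortest u in its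
   support the value would be divisible by the len(u) > d pairwise coprime forms t_j - t_k attached
   to the inversions of u.  This gives uniqueness of Schubert classes, and identifies p_{s_i}
   with the class c_i(u) = sum_{a <= i} (t_a - t_{u(a)}).  Existence follows by applying
   divided differences (p(v) - p(v s_i)) / (t_{v(i+1)} - t_{v(i)}), starting from the class
   supported at the longest element.  Finally (c_i - c_i(w)) p_w - sum p_{w(jk)} is homogeneous
   of degree len(w) + 1 and vanishes on permutations of length at most len(w) + 1, so it is zero;
   the summand c_i(w) p_w disappears in ordinary cohomology. *)

theory Submission
  imports Defs
begin

subsection \<open>Polynomials\<close>

text \<open>Two sides are in play. Edges of the moment graph multiply on the left and exchange
  values, while divided differences and the terms of the formula multiply on the right and exchange
  positions. Right multiplication by s_i commutes with the left multiplication in the GKM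
  conditions, so dividing differences along it does not leave the ring;
  \<open>comp_transpose\<close> translates between the sides. Length is defined through words, but
  the degree argument needs it as the number of edges descending from u, so the two counts must be
  identified. Coprimality of the forms t_j - t_k takes the shape of a substitution: setting t_j to
  t_k is a homomorphism into a domain, its kernel is generated by t_j - t_k, and it kills no other
  form t_a - t_b with a < b. The coefficients 1 come from the covers: if v covers w through the
  values j < k, then (t_j - t_k) p_w(v) = p_v(v), and c_i(v) - c_i(w) is t_j - t_k or 0 according to
  whether i separates the two positions.\<close>

abbreviation poly_const :: "complex \<Rightarrow> cpoly" where
  "poly_const c \<equiv> Poly_Mapping.single 0 c"

lemma update_eq_single_add:
  assumes "a \<notin> Poly_Mapping.keys f"
  shows "Poly_Mapping.update a b f = Poly_Mapping.single a b + f"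
  using assms
  by (intro poly_mapping_eqI) (auto simp: lookup_update lookup_add lookup_single when_def in_keys_iff)

lemma poly_mapping_add_induct [case_names zero single add]:
  assumes "P 0" "\<And>m c. P (Poly_Mapping.single m c)" "\<And>f g. P f \<Longrightarrow> P g \<Longrightarrow> P (f + g)"
  shows "P f"
  by (induction f rule: update_induct) (use assms in \<open>auto simp: update_eq_single_add\<close>)

section \<open>Substitution homomorphisms\<close>

definition eval_monom :: "(nat \<Rightarrow> cpoly) \<Rightarrow> (nat \<Rightarrow>\<^sub>0 nat) \<Rightarrow> cpoly" where
  "eval_monom x m = (\<Prod>i\<in>Poly_Mapping.keys m. x i ^ Poly_Mapping.lookup m i)"

text \<open>Three instances carry the algebra: killing the variables outside \<open>{1..n}\<close>,
  identifying two variables, and doubling all variables.\<close>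

definition poly_subst :: "(nat \<Rightarrow> cpoly) \<Rightarrow> cpoly \<Rightarrow> cpoly" where
  "poly_subst x f = (\<Sum>m\<in>Poly_Mapping.keys f. poly_const (Poly_Mapping.lookup f m) * eval_monom x m)"

lemma eval_monom_superset:
  assumes "finite A" "Poly_Mapping.keys m \<subseteq> A"
  shows "eval_monom x m = (\<Prod>i\<in>A. x i ^ Poly_Mapping.lookup m i)"
  unfolding eval_monom_def
  by (rule prod.mono_neutral_left) (use assms in \<open>auto simp: in_keys_iff\<close>)

lemma eval_monom_add: "eval_monom x (m + m') = eval_monom x m * eval_monom x m'"
proof -
  let ?A = "Poly_Mapping.keys m \<union> Poly_Mapping.keys m'"
  have "eval_monom x (m + m') = (\<Prod>i\<in>?A. x i ^ Poly_Mapping.lookup (m + m') i)"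
    by (rule eval_monom_superset) (use keys_add[of m m'] in auto)
  also have "\<dots> = (\<Prod>i\<in>?A. x i ^ Poly_Mapping.lookup m i) * (\<Prod>i\<in>?A. x i ^ Poly_Mapping.lookup m' i)"
    by (simp add: lookup_add power_add prod.distrib)
  also have "\<dots> = eval_monom x m * eval_monom x m'"
    by (simp add: eval_monom_superset[of ?A m] eval_monom_superset[of ?A m'])
  finally show ?thesis .
qed

lemma eval_monom_0 [simp]: "eval_monom x 0 = 1"
  by (simp add: eval_monom_def)

lemma eval_monom_single [simp]: "eval_monom x (Poly_Mapping.single i k) = x i ^ k"
  by (simp add: eval_monom_def)

lemma poly_subst_0 [simp]: "poly_subst x 0 = 0"
  by (simp add: poly_subst_def)

lemma poly_subst_single: "poly_subst x (Poly_Mapping.single m c) = poly_const c * eval_monom x m"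
  by (simp add: poly_subst_def)

lemma poly_subst_add: "poly_subst x (f + g) = poly_subst x f + poly_subst x g"
  unfolding poly_subst_def
  by (rule setsum_keys_plus_distrib) (auto simp: single_add distrib_right)

lemma poly_subst_mult: "poly_subst x (f * g) = poly_subst x f * poly_subst x g"
proof (induction f rule: poly_mapping_add_induct)
  case (single m c)
  show ?case
  proof (induction g rule: poly_mapping_add_induct)
    case (single m' c')
    have "poly_const (c * c') = poly_const c * poly_const c'"
      by (simp add: mult_single)
    then show ?case
      by (simp add: mult_single poly_subst_single eval_monom_add mult_ac)
  qed (auto simp: poly_subst_add distrib_left)
qed (auto simp: poly_subst_add distrib_right)

lemma poly_subst_const [simp]: "poly_subst x (poly_const c) = poly_const c"
  by (simp add: poly_subst_single)

lemma poly_subst_1 [simp]: "poly_subst x 1 = 1"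
  using poly_subst_const[of x 1] by simp

lemma poly_subst_tvar [simp]: "poly_subst x (tvar i) = x i"
  by (simp add: tvar_def poly_subst_single)

lemma poly_subst_uminus: "poly_subst x (- f) = - poly_subst x f"
proof -
  have "poly_subst x (- f) + poly_subst x f = 0"
    by (simp flip: poly_subst_add)
  then show ?thesis
    by (simp add: eq_neg_iff_add_eq_0)
qed

lemma poly_subst_diff: "poly_subst x (f - g) = poly_subst x f - poly_subst x g"
  using poly_subst_add[of x f "- g"] by (simp add: poly_subst_uminus)

lemma poly_subst_sum: "poly_subst x (sum f A) = (\<Sum>a\<in>A. poly_subst x (f a))"
  by (induction A rule: infinite_finite_induct) (auto simp: poly_subst_add)

lemma poly_subst_prod: "poly_subst x (prod f A) = (\<Prod>a\<in>A. poly_subst x (f a))"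
  by (induction A rule: infinite_finite_induct) (auto simp: poly_subst_mult)

lemma poly_subst_cong:
  assumes "\<And>m i. m \<in> Poly_Mapping.keys f \<Longrightarrow> i \<in> Poly_Mapping.keys m \<Longrightarrow> x i = y i"
  shows "poly_subst x f = poly_subst y f"
  unfolding poly_subst_def eval_monom_def using assms by (auto intro!: sum.cong prod.cong)

lemma tvar_power: "tvar i ^ k = Poly_Mapping.single (Poly_Mapping.single i k) 1"
  by (induction k) (auto simp: tvar_def mult_single single_add[symmetric])

lemma eval_monom_tvar: "eval_monom tvar m = Poly_Mapping.single m 1"
  by (induction m rule: poly_mapping_add_induct) (auto simp: tvar_power eval_monom_add mult_single)

lemma poly_subst_tvar_id [simp]: "poly_subst tvar f = f"
  by (induction f rule: poly_mapping_add_induct)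
    (auto simp: poly_subst_single eval_monom_tvar mult_single poly_subst_add)

lemma cpoly_induct [case_names const tvar add mult]:
  assumes "\<And>c. P (poly_const c)" "\<And>i. P (tvar i)"
    and "\<And>f g. P f \<Longrightarrow> P g \<Longrightarrow> P (f + g)" "\<And>f g. P f \<Longrightarrow> P g \<Longrightarrow> P (f * g)"
  shows "P f"
proof (induction f rule: poly_mapping_add_induct)
  case zero
  then show ?case using assms(1)[of 0] by simp
next
  case (single m c)
  have pow: "P (tvar i ^ k)" for i k
    by (induction k) (use assms(1)[of 1] assms(2,4) in auto)
  have "P (Poly_Mapping.single m 1)"
  proof (induction m rule: poly_mapping_add_induct)
    case zero
    show ?case using assms(1)[of 1] by simp
  next
    case (single i k)
    show ?case using pow[of i k] by (simp add: tvar_power)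
  next
    case (add f g)
    then show ?case using assms(4)[of "Poly_Mapping.single f 1" "Poly_Mapping.single g 1"]
      by (simp add: mult_single)
  qed
  then have "P (poly_const c * Poly_Mapping.single m 1)"
    using assms(1,4) by blast
  then show ?case by (simp add: mult_single)
qed (use assms in auto)

section \<open>The subring of polynomials in n variables\<close>

lemma polys_const [simp]: "poly_const c \<in> polys n"
  by (simp add: polys_def)

lemma polys_0 [simp]: "0 \<in> polys n" and polys_1 [simp]: "1 \<in> polys n"
  by (simp_all add: polys_def)

lemma polys_tvar [simp]: "1 \<le> i \<Longrightarrow> i \<le> n \<Longrightarrow> tvar i \<in> polys n"
  by (simp add: polys_def tvar_def)

lemma polys_add [intro]: "f \<in> polys n \<Longrightarrow> g \<in> polys n \<Longrightarrow> f + g \<in> polys n"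
  unfolding polys_def using keys_add[of f g] by blast

lemma polys_uminus [intro]: "f \<in> polys n \<Longrightarrow> - f \<in> polys n"
  unfolding polys_def by simp

lemma polys_diff [intro]: "f \<in> polys n \<Longrightarrow> g \<in> polys n \<Longrightarrow> f - g \<in> polys n"
  using polys_add[OF _ polys_uminus, of f n g] by simp

lemma polys_mult [intro]: "f \<in> polys n \<Longrightarrow> g \<in> polys n \<Longrightarrow> f * g \<in> polys n"
  unfolding polys_def
  using keys_mult[of f g] keys_add by (fastforce simp: subset_iff)

lemma polys_sum: "(\<And>a. a \<in> A \<Longrightarrow> f a \<in> polys n) \<Longrightarrow> sum f A \<in> polys n"
  by (induction A rule: infinite_finite_induct) auto

lemma polys_prod: "(\<And>a. a \<in> A \<Longrightarrow> f a \<in> polys n) \<Longrightarrow> prod f A \<in> polys n"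
  by (induction A rule: infinite_finite_induct) auto

lemma poly_subst_in_polys: "(\<And>i. x i \<in> polys n) \<Longrightarrow> poly_subst x f \<in> polys n"
  by (induction f rule: cpoly_induct) (auto simp: poly_subst_add poly_subst_mult)

lemma tvar_eq_iff [simp]: "tvar j = tvar k \<longleftrightarrow> j = k"
proof
  assume "tvar j = tvar k"
  then have "Poly_Mapping.keys (tvar j) = Poly_Mapping.keys (tvar k)" by simp
  then show "j = k" by (simp add: tvar_def) (metis keys_single singleton_inject zero_neq_one One_nat_def)
qed simp

text \<open>The retraction setting the variables outside \<open>{1..n}\<close> to zero fixes dividend and divisor,
  hence also the quotient.\<close>

lemma polys_quotient:
  assumes "f * q \<in> polys n" "f \<in> polys n" "f \<noteq> 0"
  shows "q \<in> polys n"
proof -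
  define x where "x i = (if i \<in> {1..n} then tvar i else 0)" for i
  have retract: "poly_subst x g = g" if "g \<in> polys n" for g
  proof -
    have "poly_subst x g = poly_subst tvar g"
      by (rule poly_subst_cong) (use that in \<open>fastforce simp: polys_def x_def\<close>)
    then show ?thesis by simp
  qed
  have "f * poly_subst x q = f * q"
    using retract[OF assms(1)] retract[OF assms(2)] by (simp add: poly_subst_mult)
  then have "poly_subst x q = q" using assms(3) by simp
  moreover have "poly_subst x q \<in> polys n"
    by (rule poly_subst_in_polys) (auto simp: x_def)
  ultimately show ?thesis by simp
qed

section \<open>Divisibility by differences of variables\<close>

definition ident :: "nat \<Rightarrow> nat \<Rightarrow> cpoly \<Rightarrow> cpoly" where
  "ident j k = poly_subst (tvar(j := tvar k))"

text \<open>Congruence modulo t_j - t_k passes to sums and products, so only generators need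
  checking, and the only one that moves is t_j.\<close>

lemma diff_dvd_sub_ident: "tvar j - tvar k dvd f - ident j k f"
proof (induction f rule: cpoly_induct)
  case (add f g)
  have "f + g - ident j k (f + g) = (f - ident j k f) + (g - ident j k g)"
    by (simp add: ident_def poly_subst_add)
  then show ?case using add by (metis dvd_add)
next
  case (mult f g)
  have "f * g - ident j k (f * g) = f * (g - ident j k g) + (f - ident j k f) * ident j k g"
    by (simp add: ident_def poly_subst_mult algebra_simps)
  then show ?case using mult by (metis dvd_add dvd_mult dvd_mult2)
qed (auto simp: ident_def)

text \<open>The kernel of the substitution is the ideal of t_j - t_k. A GKM condition thus becomes
  an equality of images, and t_j - t_k can be treated as a prime because the images lie in a
  domain.\<close>

lemma diff_dvd_iff: "tvar j - tvar k dvd f \<longleftrightarrow> ident j k f = 0"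
proof
  assume "tvar j - tvar k dvd f"
  then show "ident j k f = 0"
    by (auto simp: ident_def poly_subst_mult poly_subst_diff)
next
  assume "ident j k f = 0"
  then show "tvar j - tvar k dvd f"
    using diff_dvd_sub_ident[of j k f] by simp
qed

lemma ident_diff_eq_0:
  assumes "a \<noteq> b" "ident j k (tvar a - tvar b) = 0"
  shows "{a, b} = {j, k}"
  using assms by (auto simp: ident_def poly_subst_diff split: if_splits)

lemma ident_tvar_transpose: "ident j k (tvar (transpose j k a)) = ident j k (tvar a)"
  by (auto simp: ident_def transpose_def)

text \<open>Induction on the set: modulo t_j - t_k none of the factors already split off vanishes,
  so the vanishing of f passes to the cofactor. Requiring a < b keeps one orientation of each pair;
  the forms of (a, b) and (b, a) are associated.\<close>

lemma prod_diff_dvd: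
  assumes "finite A" "\<And>a b. (a, b) \<in> A \<Longrightarrow> a < b \<and> tvar a - tvar b dvd f"
  shows "(\<Prod>(a, b)\<in>A. tvar a - tvar b) dvd f"
  using assms
proof (induction A)
  case (insert p A)
  obtain j k where p: "p = (j, k)" by (cases p)
  have "(\<Prod>(a, b)\<in>A. tvar a - tvar b) dvd f"
    using insert by blast
  then obtain q where q: "f = (\<Prod>(a, b)\<in>A. tvar a - tvar b) * q" by (elim dvdE)
  have jk: "j < k" "ident j k f = 0"
    using insert.prems[of j k] p by (auto simp: diff_dvd_iff)
  have "ident j k (\<Prod>(a, b)\<in>A. tvar a - tvar b) \<noteq> 0"
  proof
    assume "ident j k (\<Prod>(a, b)\<in>A. tvar a - tvar b) = 0"
    then obtain a b where "(a, b) \<in> A" "ident j k (tvar a - tvar b) = 0"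
      using insert.hyps(1) by (auto simp: ident_def poly_subst_prod)
    moreover have "a < b" using insert.prems[of a b] \<open>(a, b) \<in> A\<close> by simp
    ultimately have "(a, b) = (j, k)"
      using ident_diff_eq_0[of a b j k] jk(1) by (auto simp: doubleton_eq_iff)
    then show False using \<open>(a, b) \<in> A\<close> insert.hyps(2) p by blast
  qed
  then have "ident j k q = 0"
    using jk(2) q by (simp add: ident_def poly_subst_mult)
  then obtain r where "q = (tvar j - tvar k) * r"
    by (auto simp flip: diff_dvd_iff)
  then show ?case
    using q insert.hyps p by (simp add: mult_ac)
qed simp

section \<open>Homogeneous polynomials\<close>

abbreviation tdegree :: "(nat \<Rightarrow>\<^sub>0 nat) \<Rightarrow> nat" where
  "tdegree m \<equiv> \<Sum>i\<in>Poly_Mapping.keys m. Poly_Mapping.lookup m i"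

text \<open>Homogeneity is an eigenvector condition for doubling all variables, so that a ring
  homomorphism and cancellation handle products and quotients.\<close>

definition scale2 :: "cpoly \<Rightarrow> cpoly" where
  "scale2 = poly_subst (\<lambda>i. poly_const 2 * tvar i)"

lemma lookup_const_mult: "Poly_Mapping.lookup (poly_const c * f) m = c * Poly_Mapping.lookup f m"
  by (induction f rule: poly_mapping_add_induct)
    (auto simp: mult_single lookup_single when_def distrib_left lookup_add)

lemma poly_const_power: "poly_const c ^ k = poly_const (c ^ k)"
  by (induction k) (auto simp: mult_single)

lemma poly_const_prod: "(\<Prod>a\<in>A. poly_const (f a)) = poly_const (\<Prod>a\<in>A. f a)"
  by (induction A rule: infinite_finite_induct) (auto simp: mult_single)

lemma lookup_scale2: "Poly_Mapping.lookup (scale2 f) m = 2 ^ tdegree m * Poly_Mapping.lookup f m"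
proof (induction f rule: poly_mapping_add_induct)
  case (single m' c)
  have "eval_monom (\<lambda>i. poly_const 2 * tvar i) m' = poly_const (2 ^ tdegree m') * eval_monom tvar m'"
    by (simp only: eval_monom_def power_mult_distrib prod.distrib poly_const_power poly_const_prod power_sum)
  then have "scale2 (Poly_Mapping.single m' c) = Poly_Mapping.single m' (c * 2 ^ tdegree m')"
    by (simp add: scale2_def poly_subst_single eval_monom_tvar mult_single mult_ac)
  then show ?case by (simp add: lookup_single when_def)
qed (auto simp: scale2_def poly_subst_add lookup_add distrib_left)

text \<open>Distinct powers of 2 stay distinct in the complex numbers, so the eigenvalue determines
  the degree of every monomial that occurs.\<close>

lemma homogeneous_iff_scale2: "homogeneous d f \<longleftrightarrow> scale2 f = poly_const (2 ^ d) * f"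
proof -
  have "scale2 f = poly_const (2 ^ d) * f \<longleftrightarrow>
      (\<forall>m. (2::complex) ^ tdegree m * Poly_Mapping.lookup f m = 2 ^ d * Poly_Mapping.lookup f m)"
    by (simp add: poly_mapping_eq_iff fun_eq_iff lookup_scale2 lookup_const_mult)
  also have "\<dots> \<longleftrightarrow> (\<forall>m. Poly_Mapping.lookup f m = 0 \<or> tdegree m = d)"
  proof -
    have "(2::complex) ^ a = 2 ^ b \<longleftrightarrow> a = b" for a b :: nat
    proof
      assume "(2::complex) ^ a = 2 ^ b"
      then have "of_nat (2 ^ a) = (of_nat (2 ^ b) :: complex)" by simp
      then have "(2::nat) ^ a = 2 ^ b" by (simp only: of_nat_eq_iff)
      then show "a = b" by simp
    qed simp
    then show ?thesis by auto
  qed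
  finally show ?thesis by (auto simp: homogeneous_def in_keys_iff)
qed

lemma homogeneous_0 [simp]: "homogeneous d 0"
  by (simp add: homogeneous_def)

lemma homogeneous_const [simp]: "homogeneous 0 (poly_const c)"
  by (simp add: homogeneous_def)

lemma homogeneous_tvar [simp]: "homogeneous 1 (tvar i)"
  by (simp add: homogeneous_def tvar_def)

lemma homogeneous_add: "homogeneous d f \<Longrightarrow> homogeneous d g \<Longrightarrow> homogeneous d (f + g)"
  by (simp add: homogeneous_iff_scale2) (simp add: scale2_def poly_subst_add distrib_left)

lemma homogeneous_diff: "homogeneous d f \<Longrightarrow> homogeneous d g \<Longrightarrow> homogeneous d (f - g)"
  by (simp add: homogeneous_iff_scale2) (simp add: scale2_def poly_subst_diff right_diff_distrib)

lemma homogeneous_sum: "(\<And>a. a \<in> A \<Longrightarrow> homogeneous d (f a)) \<Longrightarrow> homogeneous d (sum f A)"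
  by (induction A rule: infinite_finite_induct) (auto intro: homogeneous_add)

lemma homogeneous_mult:
  assumes "homogeneous d f" "homogeneous e g"
  shows "homogeneous (d + e) (f * g)"
proof -
  have "poly_const (2 ^ (d + e)) = poly_const (2 ^ d) * poly_const (2 ^ e)"
    by (simp add: mult_single power_add)
  moreover have "scale2 (f * g) = scale2 f * scale2 g"
    by (simp add: scale2_def poly_subst_mult)
  ultimately show ?thesis
    using assms by (simp add: homogeneous_iff_scale2 mult_ac)
qed

lemma homogeneous_prod_diff:
  "finite A \<Longrightarrow> homogeneous (card A) (\<Prod>(a, b)\<in>A. tvar a - tvar b)"
proof (induction A rule: finite_induct)
  case empty
  then show ?case using homogeneous_const[of 1] by simp
next
  case (insert p A)
  have "homogeneous 1 (case p of (a, b) \<Rightarrow> tvar a - tvar b)"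
    using homogeneous_diff[OF homogeneous_tvar homogeneous_tvar] by (cases p) simp
  from homogeneous_mult[OF this insert.IH] show ?case
    using insert.hyps by simp
qed

text \<open>Cancelling f in the eigenvector equations leaves one for q. The degree equation is
  additive so that it serves two purposes: it gives the degree of a quotient, and for d < e it
  leaves q without monomials.\<close>

lemma homogeneous_quotient_keys:
  assumes "homogeneous d (f * q)" "homogeneous e f" "f \<noteq> 0" "m \<in> Poly_Mapping.keys q"
  shows "tdegree m + e = d"
proof -
  have "f * (poly_const (2 ^ e) * scale2 q) = scale2 f * scale2 q"
    using assms(2) by (simp add: homogeneous_iff_scale2 mult_ac)
  also have "\<dots> = f * (poly_const (2 ^ d) * q)"
    using assms(1) by (simp add: homogeneous_iff_scale2) (simp add: scale2_def poly_subst_mult mult_ac)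
  finally have "poly_const (2 ^ e) * scale2 q = poly_const (2 ^ d) * q"
    using assms(3) by simp
  then have "Poly_Mapping.lookup (poly_const (2 ^ e) * scale2 q) m = Poly_Mapping.lookup (poly_const (2 ^ d) * q) m"
    by simp
  then have "(2::complex) ^ (tdegree m + e) = 2 ^ d"
    using assms(4) by (simp only: lookup_const_mult lookup_scale2 in_keys_iff power_add) (simp add: mult.commute)
  then have "of_nat (2 ^ (tdegree m + e)) = (of_nat (2 ^ d) :: complex)" by simp
  then have "(2::nat) ^ (tdegree m + e) = 2 ^ d" by (simp only: of_nat_eq_iff)
  then show ?thesis by simp
qed

lemma homogeneous_quotient:
  assumes "homogeneous (d + e) (f * q)" "homogeneous e f" "f \<noteq> 0"
  shows "homogeneous d q"
  using homogeneous_quotient_keys[OF assms] by (simp add: homogeneous_def)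

lemma homogeneous_quotient_0:
  assumes "homogeneous d (f * q)" "homogeneous e f" "d < e"
  shows "f * q = 0"
proof (cases "f = 0")
  case False
  then have "Poly_Mapping.keys q = {}"
    using homogeneous_quotient_keys[OF assms(1,2)] assms(3) by fastforce
  then show ?thesis by simp
qed simp

lemma homogeneous_0_const:
  assumes "homogeneous 0 f"
  obtains c where "f = poly_const c"
proof
  have "m = 0" if "m \<in> Poly_Mapping.keys f" for m
  proof -
    have "Poly_Mapping.lookup m i = 0" if "i \<in> Poly_Mapping.keys m" for i
      using assms \<open>m \<in> Poly_Mapping.keys f\<close> that by (auto simp: homogeneous_def)
    then show ?thesis by (intro poly_mapping_eqI) (metis in_keys_iff lookup_zero)
  qed
  then show "f = poly_const (Poly_Mapping.lookup f 0)"
    by (intro poly_mapping_eqI) (auto simp: lookup_single when_def in_keys_iff)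
qed

subsection \<open>Inversions and Bruhat order\<close>

text \<open>The token \<open>inv\<close> also has a reading as the inverse in an algebraic structure.\<close>

abbreviation winv :: "(nat \<Rightarrow> nat) \<Rightarrow> nat \<Rightarrow> nat" where
  "winv \<equiv> inv_into UNIV"

text \<open>Pairs of values, not of positions: b > a stands before a in the one-line notation. These
  pairs label the edges descending from w, because edges exchange values.\<close>

definition inversions :: "nat \<Rightarrow> (nat \<Rightarrow> nat) \<Rightarrow> (nat \<times> nat) set" where
  "inversions n w = {(a, b). 1 \<le> a \<and> a < b \<and> b \<le> n \<and> winv w b < winv w a}"

lemma finite_inversions [simp]: "finite (inversions n w)"
  by (rule finite_subset[of _ "{1..n} \<times> {1..n}"]) (auto simp: inversions_def)

lemma Sym_bij: "w \<in> Sym n \<Longrightarrow> bij w"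
  by (auto simp: Sym_def permutes_bij)

lemma Sym_id [simp]: "id \<in> Sym n"
  by (simp add: Sym_def permutes_id)

lemma Sym_range: "w \<in> Sym n \<Longrightarrow> 1 \<le> a \<Longrightarrow> a \<le> n \<Longrightarrow> 1 \<le> w a \<and> w a \<le> n"
  using permutes_in_image[of w "{1..n}" a] by (auto simp: Sym_def)

lemma Sym_inv: "w \<in> Sym n \<Longrightarrow> winv w \<in> Sym n"
  by (simp add: Sym_def permutes_inv)

lemma Sym_inv_eq: "w \<in> Sym n \<Longrightarrow> winv w a = b \<longleftrightarrow> a = w b"
  by (auto simp: Sym_def permutes_inv_eq)

lemma Sym_inverse [simp]: "w \<in> Sym n \<Longrightarrow> winv w (w a) = a" "w \<in> Sym n \<Longrightarrow> w (winv w a) = a"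
  by (auto simp: Sym_def permutes_inverses)

lemma Sym_eq_iff: "w \<in> Sym n \<Longrightarrow> w a = w b \<longleftrightarrow> a = b"
  by (metis Sym_inverse(1))

lemma Sym_transpose: "1 \<le> j \<Longrightarrow> j \<le> n \<Longrightarrow> 1 \<le> k \<Longrightarrow> k \<le> n \<Longrightarrow> transpose j k \<in> Sym n"
  by (simp add: Sym_def permutes_swap_id)

lemma Sym_comp: "u \<in> Sym n \<Longrightarrow> v \<in> Sym n \<Longrightarrow> u \<circ> v \<in> Sym n"
  by (simp add: Sym_def permutes_compose)

lemma inv_transpose_comp: "w \<in> Sym n \<Longrightarrow> winv (transpose j k \<circ> w) = winv w \<circ> transpose j k"
  by (simp add: o_inv_distrib Sym_bij)

text \<open>The bridge between right multiplication, which exchanges positions, and the edges of the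
  moment graph, which exchange values.\<close>

lemma comp_transpose: "w \<in> Sym n \<Longrightarrow> w \<circ> transpose a b = transpose (w a) (w b) \<circ> w"
  by (auto simp: fun_eq_iff transpose_def Sym_eq_iff)

text \<open>Swapping the entries \<open>j\<close> and \<open>k\<close> preserves the order of a pair unless both
  entries lie in \<open>{j..k}\<close>; such pairs are kept.\<close>

definition pair_swap :: "nat \<Rightarrow> nat \<Rightarrow> nat \<times> nat \<Rightarrow> nat \<times> nat" where
  "pair_swap j k = (\<lambda>(a, b). if j \<le> a \<and> b \<le> k then (a, b) else (transpose j k a, transpose j k b))"

lemma transpose_less:
  fixes a b :: nat
  assumes "a < b" "\<not> (j \<le> a \<and> b \<le> k)" "j < k"
  shows "transpose j k a < transpose j k b"
  using assms by (auto simp: transpose_def)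

lemma transpose_in_range:
  assumes "j < k"
  shows "j \<le> transpose j k a \<longleftrightarrow> j \<le> (a::nat)" "transpose j k a \<le> k \<longleftrightarrow> a \<le> k"
  using assms by (auto simp: transpose_def)

lemma pair_swap_involution: "j < k \<Longrightarrow> pair_swap j k (pair_swap j k p) = p"
  by (auto simp: pair_swap_def transpose_in_range split: prod.splits if_splits)

lemma pair_swap_inj: "j < k \<Longrightarrow> inj_on (pair_swap j k) A"
  by (metis inj_onI pair_swap_involution)

text \<open>A pair that is moved along with the swap occupies the same positions as before. A kept
  pair stays inverted because the swap can only move its smaller entry j to a later place and its
  larger entry k to an earlier one.\<close>

lemma pair_swap_inversions:
  assumes w: "w \<in> Sym n" and jk: "1 \<le> j" "j < k" "k \<le> n" "winv w j < winv w k"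
  shows "pair_swap j k ` inversions n w \<subseteq> inversions n (transpose j k \<circ> w) - {(j, k)}"
proof (rule image_subsetI)
  fix p assume p: "p \<in> inversions n w"
  obtain a b where ab: "p = (a, b)" by (cases p)
  with p have ab': "1 \<le> a" "a < b" "b \<le> n" "winv w b < winv w a"
    by (auto simp: inversions_def)
  have "(a, b) \<noteq> (j, k)" using ab' jk by auto
  show "pair_swap j k p \<in> inversions n (transpose j k \<circ> w) - {(j, k)}"
  proof (cases "j \<le> a \<and> b \<le> k")
    case True
    have "winv w (transpose j k b) < winv w (transpose j k a)"
      using \<open>(a, b) \<noteq> (j, k)\<close> ab' jk True by (auto simp: transpose_def)
    then show ?thesis
      using True ab' \<open>(a, b) \<noteq> (j, k)\<close>
      by (auto simp: ab pair_swap_def inversions_def inv_transpose_comp[OF w])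
  next
    case False
    have "1 \<le> transpose j k a" "transpose j k b \<le> n" using ab' jk by (auto simp: transpose_def)
    moreover have "(transpose j k a, transpose j k b) \<noteq> (j, k)"
      using False transpose_in_range[OF jk(2)] by (metis order_refl prod.inject)
    ultimately show ?thesis
      using False ab' transpose_less[OF ab'(2) False jk(2)]
      by (auto simp: ab pair_swap_def inversions_def inv_transpose_comp[OF w])
  qed
qed

lemma transposed_in_inversions:
  assumes "w \<in> Sym n" "1 \<le> j" "j < k" "k \<le> n" "winv w j < winv w k"
  shows "(j, k) \<in> inversions n (transpose j k \<circ> w)"
  using assms by (auto simp: inversions_def inv_transpose_comp)

text \<open>Strictness comes from the new inversion (j, k), which the injection
  \<open>pair_swap\<close> misses.\<close>

lemma card_inversions_less:
  assumes "w \<in> Sym n" "1 \<le> j" "j < k" "k \<le> n" "winv w j < winv w k"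
  shows "card (inversions n w) < card (inversions n (transpose j k \<circ> w))"
proof -
  have "card (inversions n w) = card (pair_swap j k ` inversions n w)"
    by (simp add: card_image pair_swap_inj assms)
  also have "\<dots> \<le> card (inversions n (transpose j k \<circ> w) - {(j, k)})"
    by (intro card_mono pair_swap_inversions assms finite_Diff finite_inversions)
  also have "\<dots> < card (inversions n (transpose j k \<circ> w))"
    by (rule card_Diff1_less) (use transposed_in_inversions assms in auto)
  finally show ?thesis .
qed

lemma card_inversions_less_iff:
  assumes "w \<in> Sym n" "1 \<le> j" "j < k" "k \<le> n"
  shows "card (inversions n (transpose j k \<circ> w)) < card (inversions n w) \<longleftrightarrow> winv w k < winv w j"
proof
  assume less: "card (inversions n (transpose j k \<circ> w)) < card (inversions n w)"
  have "winv w j \<noteq> winv w k"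
    using assms Sym_eq_iff[OF Sym_inv] by fastforce
  then show "winv w k < winv w j"
    using less card_inversions_less[OF assms] by fastforce
next
  assume "winv w k < winv w j"
  then have "winv (transpose j k \<circ> w) j < winv (transpose j k \<circ> w) k"
    using assms by (simp add: inv_transpose_comp)
  moreover have "transpose j k \<circ> w \<in> Sym n"
    using assms by (intro Sym_comp Sym_transpose) auto
  moreover have "transpose j k \<circ> (transpose j k \<circ> w) = w"
    by (simp add: comp_assoc[symmetric])
  ultimately show "card (inversions n (transpose j k \<circ> w)) < card (inversions n w)"
    using card_inversions_less[of "transpose j k \<circ> w" n j k] assms by simp
qed

text \<open>Exchanging adjacent values preserves the numerical order of every other pair, so only
  (i, i + 1) can be a new inversion. This makes the number of inversions a lower bound for the
  number of letters of a word.\<close>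

lemma card_inversions_simple_le:
  assumes "w \<in> Sym n" "1 \<le> i" "i < n"
  shows "card (inversions n (simple_refl i \<circ> w)) \<le> Suc (card (inversions n w))"
proof -
  let ?s = "simple_refl i"
  have "map_prod ?s ?s ` (inversions n (?s \<circ> w) - {(i, i + 1)}) \<subseteq> inversions n w"
  proof (rule image_subsetI)
    fix p assume p: "p \<in> inversions n (?s \<circ> w) - {(i, i + 1)}"
    obtain a b where ab: "p = (a, b)" by (cases p)
    have ne: "a = i \<longrightarrow> b \<noteq> Suc i" using p ab by auto
    from p ab have ab': "1 \<le> a" "a < b" "b \<le> n" "winv w (?s b) < winv w (?s a)"
      by (auto simp: inversions_def inv_transpose_comp[OF assms(1)])
    moreover have "?s a < ?s b" using transpose_less[of a b i "i+1"] ab' ne by auto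
    moreover have "1 \<le> ?s a" "?s b \<le> n" using ab' assms by (auto simp: transpose_def)
    ultimately show "map_prod ?s ?s p \<in> inversions n w"
      by (simp add: ab inversions_def)
  qed
  moreover have "inj_on (map_prod ?s ?s) A" for A
    by (auto simp: inj_on_def dest: injD[OF inj_transpose])
  ultimately have "card (inversions n (?s \<circ> w) - {(i, i + 1)}) \<le> card (inversions n w)"
    by (metis card_inj_on_le finite_inversions)
  then show ?thesis
    using card_Diff_singleton_if[of "inversions n (?s \<circ> w)" "(i, i + 1)"]
    by (auto split: if_splits)
qed

lemma Sym_increasing_id:
  assumes w: "w \<in> Sym n" and inc: "\<And>i. 1 \<le> i \<Longrightarrow> i < n \<Longrightarrow> winv w i < winv w (i + 1)"
  shows "w = id"
proof -
  let ?P = "winv w"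
  have P: "?P \<in> Sym n" using Sym_inv[OF w] .
  have ge: "a \<le> ?P a" if "1 \<le> a" "a \<le> n" for a
    using that
  proof (induction a)
    case (Suc a)
    show ?case
    proof (cases "a = 0")
      case True then show ?thesis using Sym_range[OF P] Suc.prems by auto
    next
      case False
      then show ?thesis using Suc inc[of a] by simp
    qed
  qed simp
  have le: "?P (n - d) \<le> n - d" if "d < n" for d
    using that
  proof (induction d)
    case 0
    then show ?case using Sym_range[OF P, of n] by simp
  next
    case (Suc d)
    then have "winv w (n - Suc d) < winv w (n - d)"
      using inc[of "n - Suc d"] by (simp add: Suc_diff_Suc)
    then show ?case using Suc by simp
  qed
  have "?P a = a" for a
  proof (cases "1 \<le> a \<and> a \<le> n")
    case True
    then show ?thesis using ge[of a] le[of "n - a"] by simp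
  next
    case False
    then show ?thesis using P by (auto simp: Sym_def permutes_def)
  qed
  then show ?thesis using Sym_inv_eq[OF w] by fastforce
qed

section \<open>Length as the number of inversions\<close>

abbreviation word_perm :: "nat list \<Rightarrow> nat \<Rightarrow> nat" where
  "word_perm is \<equiv> foldr (\<lambda>i u. simple_refl i \<circ> u) is id"

lemma word_perm_bound:
  assumes "set is \<subseteq> {1..<n}"
  shows "word_perm is \<in> Sym n \<and> card (inversions n (word_perm is)) \<le> length is"
  using assms
proof (induction "is")
  case Nil
  have "inversions n id = {}" by (auto simp: inversions_def)
  then show ?case using Sym_id[of n] by (simp add: id_def)
next
  case (Cons i "is")
  then have sub: "set is \<subseteq> {1..<n}" and i: "1 \<le> i" "i < n" by auto
  note IH = conjunct1[OF Cons.IH[OF sub]] conjunct2[OF Cons.IH[OF sub]]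
  have eq: "word_perm (i # is) = simple_refl i \<circ> word_perm is"
    by (simp only: foldr.simps o_apply)
  have "word_perm (i # is) \<in> Sym n"
    unfolding eq by (intro Sym_comp Sym_transpose IH(1)) (use i in auto)
  moreover have "card (inversions n (word_perm (i # is))) \<le> length (i # is)"
    unfolding eq 
    by (rule order_trans[OF card_inversions_simple_le[OF IH(1) i]]) (simp only: length_Cons Suc_le_mono IH(2))
  ultimately show ?case by (rule conjI)
qed

text \<open>Bubble sort: as long as some adjacent values i, i + 1 stand in the wrong order,
  exchanging them removes an inversion. A strict decrease suffices, since
  \<open>word_perm_bound\<close> gives the opposite inequality.\<close>

lemma word_perm_exists:
  assumes "w \<in> Sym n"
  shows "\<exists>is. length is \<le> card (inversions n w) \<and> set is \<subseteq> {1..<n} \<and> w = word_perm is"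
  using assms
proof (induction "card (inversions n w)" arbitrary: w rule: less_induct)
  case less
  show ?case
  proof (cases "\<forall>i. 1 \<le> i \<and> i < n \<longrightarrow> winv w i < winv w (i + 1)")
    case True
    then have "w = id" using Sym_increasing_id less.prems by blast
    then show ?thesis by (intro exI[of _ "[]"]) simp
  next
    case False
    then obtain i where i: "1 \<le> i" "i < n" "\<not> winv w i < winv w (i + 1)" by blast
    moreover have "winv w i \<noteq> winv w (i + 1)"
      using Sym_eq_iff[OF Sym_inv[OF less.prems]] by simp
    ultimately have "winv w (i + 1) < winv w i" by simp
    then have *: "card (inversions n (simple_refl i \<circ> w)) < card (inversions n w)"
      using card_inversions_less_iff[OF less.prems, of i "i + 1"] i by simp
    moreover have "simple_refl i \<circ> w \<in> Sym n"
      using i less.prems by (intro Sym_comp Sym_transpose) auto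
    ultimately obtain "is" where "is": "length is \<le> card (inversions n (simple_refl i \<circ> w))"
      "set is \<subseteq> {1..<n}" "simple_refl i \<circ> w = word_perm is"
      using less.hyps by blast
    have "w = simple_refl i \<circ> (simple_refl i \<circ> w)" by (simp add: comp_assoc[symmetric])
    then have "w = word_perm (i # is)" using "is"(3) by simp
    then show ?thesis using "is" * i by (intro exI[of _ "i # is"]) auto
  qed
qed

lemma len_eq_card_inversions:
  assumes "w \<in> Sym n"
  shows "len n w = card (inversions n w)"
proof -
  let ?Q = "\<lambda>m. \<exists>is. length is = m \<and> set is \<subseteq> {1..<n} \<and> w = word_perm is"
  obtain "is" where "is": "length is \<le> card (inversions n w)" "set is \<subseteq> {1..<n}" "w = word_perm is"
    using word_perm_exists[OF assms] by blast
  have "len n w \<le> length is"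
    unfolding len_def by (rule Least_le) (use "is" in blast)
  moreover have "?Q (len n w)"
    unfolding len_def by (rule LeastI[of ?Q "length is"]) (use "is" in blast)
  then have "card (inversions n w) \<le> len n w"
    using word_perm_bound by metis
  ultimately show ?thesis using "is"(1) by simp
qed

lemma len_transpose_less_iff:
  assumes "w \<in> Sym n" "1 \<le> j" "j < k" "k \<le> n"
  shows "len n (transpose j k \<circ> w) < len n w \<longleftrightarrow> winv w k < winv w j"
proof -
  have "transpose j k \<circ> w \<in> Sym n"
    using assms by (intro Sym_comp Sym_transpose) auto
  then show ?thesis
    using assms by (simp add: len_eq_card_inversions card_inversions_less_iff)
qed

lemma inversions_eq_len:
  assumes "w \<in> Sym n"
  shows "{(j, k). 1 \<le> j \<and> j < k \<and> k \<le> n \<and> len n (transpose j k \<circ> w) < len n w} = inversions n w"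
  using len_transpose_less_iff[OF assms] by (auto simp: inversions_def)

section \<open>Edges, Bruhat order and right multiplication by simple reflections\<close>

lemma moment_edge_iff:
  "moment_edge n v u \<longleftrightarrow> v \<in> Sym n \<and> (\<exists>(j, k)\<in>inversions n v. u = transpose j k \<circ> v)"
  unfolding moment_edge_def
  using len_transpose_less_iff by (fastforce simp: inversions_def)

lemma moment_edge_Sym: "moment_edge n v u \<Longrightarrow> u \<in> Sym n"
  unfolding moment_edge_def by (auto intro!: Sym_comp Sym_transpose)

lemma moment_edge_len: "moment_edge n v u \<Longrightarrow> len n u < len n v"
  by (auto simp: moment_edge_def)

text \<open>Every edge lowers the length, so a chain of at least two edges lowers it by at least 2.
  Up to length \<open>len n w + 1\<close> the support of a Schubert class therefore consists of w
  and direct neighbours only.\<close>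

lemma bruhat_ge_cases:
  assumes "bruhat_ge n u w"
  shows "u = w \<or> moment_edge n u w \<or> len n u \<ge> len n w + 2"
  using assms unfolding bruhat_ge_def
proof (induction rule: converse_rtranclp_induct)
  case (step y z)
  then show ?case using moment_edge_len by (metis One_nat_def Suc_leI add_2_eq_Suc' add_Suc_right
        le_trans less_imp_le_nat nat_less_le not_less_eq_eq)
qed simp

text \<open>Only the two values standing in the adjacent positions i and i + 1 change their relative
  order.\<close>

lemma inversions_comp_simple:
  assumes w: "w \<in> Sym n" and i: "1 \<le> i" "i < n" "w (i + 1) < w i"
  shows "inversions n (w \<circ> simple_refl i) = inversions n w - {(w (i + 1), w i)}"
    and "(w (i + 1), w i) \<in> inversions n w"
proof -
  have s: "simple_refl i \<in> Sym n" using i by (intro Sym_transpose) auto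
  have inv: "winv (w \<circ> simple_refl i) = simple_refl i \<circ> winv w"
    using w by (simp add: o_inv_distrib Sym_bij)
  show "(w (i + 1), w i) \<in> inversions n w"
    using Sym_range[OF w, of i] Sym_range[OF w, of "i + 1"] i Sym_inverse(1)[OF w]
    by (simp add: inversions_def)
  have *: "simple_refl i (winv w b) < simple_refl i (winv w a) \<longleftrightarrow> winv w b < winv w a \<and> (a, b) \<noteq> (w (i + 1), w i)"
    if "a < b" for a b
  proof -
    have eqs: "winv w a = i + 1 \<longleftrightarrow> a = w (i + 1)" "winv w b = i \<longleftrightarrow> b = w i"
       "winv w a = i \<longleftrightarrow> a = w i" "winv w b = i + 1 \<longleftrightarrow> b = w (i + 1)"
      using Sym_inv_eq[OF w] by auto
    have ne: "winv w a \<noteq> winv w b" using Sym_eq_iff[OF Sym_inv[OF w]] that by simp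
    \<comment> \<open>These positions would give a = w i and b = w (i + 1), against a < b.\<close>
    have no: "\<not> (winv w a = i \<and> winv w b = i + 1)" using eqs i(3) that by auto
    show ?thesis
    proof (cases "winv w a = i + 1 \<and> winv w b = i")
      case True
      then show ?thesis using eqs by auto
    next
      case False
      have ab: "(a, b) \<noteq> (w (i + 1), w i)" using False eqs by auto
      show ?thesis
        using transpose_less[of "winv w a" "winv w b" i "i + 1"] transpose_less[of "winv w b" "winv w a" i "i + 1"]
          ne no False ab by linarith
    qed
  qed
  have "(a, b) \<in> inversions n (w \<circ> simple_refl i) \<longleftrightarrow> (a, b) \<in> inversions n w - {(w (i + 1), w i)}" for a b
    unfolding inversions_def inv using *[of a b] by auto
  then show "inversions n (w \<circ> simple_refl i) = inversions n w - {(w (i + 1), w i)}"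
    by (intro equalityI subrelI) blast+
qed

lemma moment_edge_comp_simple:
  assumes w: "w \<in> Sym n" and i: "1 \<le> i" "i < n" "w (i + 1) < w i"
  shows "moment_edge n w (w \<circ> simple_refl i)" "len n w = Suc (len n (w \<circ> simple_refl i))"
proof -
  have "w \<circ> simple_refl i = transpose (w (i + 1)) (w i) \<circ> w"
    using comp_transpose[OF w, of i "i + 1"] by (simp add: transpose_commute)
  then show "moment_edge n w (w \<circ> simple_refl i)"
    using inversions_comp_simple(2)[OF assms] w by (auto simp: moment_edge_iff)
  have "w \<circ> simple_refl i \<in> Sym n"
    using w i by (intro Sym_comp Sym_transpose) auto
  then show "len n w = Suc (len n (w \<circ> simple_refl i))"
    using inversions_comp_simple[OF assms] w
    by (simp add: len_eq_card_inversions card_Suc_Diff1 del: card_Diff_insert)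
qed

text \<open>The translated edge exchanges the same values j and k. It still descends unless they
  stand exactly in the positions i + 1 and i, and in that case the edge is right multiplication by
  s_i itself.\<close>

lemma moment_edge_lift:
  assumes e: "moment_edge n x y" and i: "1 \<le> i" "i < n"
  shows "x \<circ> simple_refl i = y \<or> moment_edge n (x \<circ> simple_refl i) (y \<circ> simple_refl i)"
proof -
  obtain j k where x: "x \<in> Sym n" and jk: "(j, k) \<in> inversions n x" and y: "y = transpose j k \<circ> x"
    using e by (auto simp: moment_edge_iff)
  have jk': "1 \<le> j" "j < k" "k \<le> n" "winv x k < winv x j" using jk by (auto simp: inversions_def)
  have inv: "winv (x \<circ> simple_refl i) = simple_refl i \<circ> winv x"
    using x by (simp add: o_inv_distrib Sym_bij)
  show ?thesis
  proof (cases "winv x k = i \<and> winv x j = i + 1")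
    case True
    then have "k = x i" "j = x (i + 1)" using Sym_inv_eq[OF x] by auto
    then show ?thesis using y comp_transpose[OF x, of i "i + 1"] by (simp add: transpose_commute)
  next
    case False
    then have "simple_refl i (winv x k) < simple_refl i (winv x j)"
      using jk'(4) by (intro transpose_less) auto
    then have "(j, k) \<in> inversions n (x \<circ> simple_refl i)"
      unfolding inversions_def inv using jk' by simp
    moreover have "x \<circ> simple_refl i \<in> Sym n"
      using x i by (intro Sym_comp Sym_transpose) auto
    ultimately show ?thesis using y by (auto simp: moment_edge_iff comp_assoc)
  qed
qed

text \<open>The lifting property: a chain is translated edge by edge. Where an edge collapses, the
  rest of the original chain is used untranslated and prolonged by the edge from w to w s_i.\<close>

lemma bruhat_ge_lift:
  assumes "bruhat_ge n x w" and i: "1 \<le> i" "i < n" and w: "moment_edge n w (w \<circ> simple_refl i)"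
  shows "bruhat_ge n (x \<circ> simple_refl i) (w \<circ> simple_refl i)"
  using assms(1) unfolding bruhat_ge_def
proof (induction rule: converse_rtranclp_induct)
  case (step x y)
  show ?case
  proof (cases "x \<circ> simple_refl i = y")
    case True
    then show ?thesis using step(2) w rtranclp.rtrancl_into_rtrancl by metis
  next
    case False
    then show ?thesis using moment_edge_lift[OF step(1) i] step(3) by (meson converse_rtranclp_into_rtranclp)
  qed
qed simp

text \<open>The inverse of a decreasing permutation is decreasing. This recognizes the longest
  element, where the existence proof starts.\<close>

lemma descending_inversions:
  assumes w: "w \<in> Sym n" and "\<And>i. 1 \<le> i \<Longrightarrow> i < n \<Longrightarrow> w (i + 1) < w i"
  shows "inversions n w = {(a, b). 1 \<le> a \<and> a < b \<and> b \<le> n}"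
proof -
  have dec: "w b < w a" if "1 \<le> a" "a < b" "b \<le> n" for a b
    using that(2,3)
  proof (induction b)
    case (Suc b)
    then show ?case using assms(2)[of b] that(1) by (cases "a = b") fastforce+
  qed simp
  have "winv w b < winv w a" if "1 \<le> a" "a < b" "b \<le> n" for a b
  proof (rule ccontr)
    assume "\<not> winv w b < winv w a"
    moreover have "winv w b \<noteq> winv w a" using Sym_eq_iff[OF Sym_inv[OF w]] that by simp
    ultimately have "w (winv w b) < w (winv w a)"
      using Sym_range[OF Sym_inv[OF w], of a] Sym_range[OF Sym_inv[OF w], of b] that
      by (intro dec) auto
    then show False using that w by simp
  qed
  then show ?thesis by (auto simp: inversions_def)
qed

subsection \<open>GKM classes\<close>

text \<open>Membership in \<open>HT\<close> without extensionality, so that formulas can be used as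
  tuples directly. Divisibility may be taken in the full polynomial ring because
  \<open>polys_quotient\<close> puts the quotient back into \<open>polys n\<close>.\<close>

definition gkm :: "nat \<Rightarrow> ((nat \<Rightarrow> nat) \<Rightarrow> cpoly) \<Rightarrow> bool" where
  "gkm n p \<longleftrightarrow> (\<forall>v\<in>Sym n. p v \<in> polys n) \<and>
     (\<forall>v\<in>Sym n. \<forall>j k. 1 \<le> j \<and> j < k \<and> k \<le> n \<longrightarrow> tvar j - tvar k dvd p v - p (transpose j k \<circ> v))"

lemma HT_carrier_iff: "p \<in> carrier (HT n) \<longleftrightarrow> gkm n p \<and> p \<in> extensional (Sym n)"
proof -
  have "tvar j - tvar k dvd p v - p (transpose j k \<circ> v) \<longleftrightarrow>
      (\<exists>q\<in>polys n. p v - p (transpose j k \<circ> v) = (tvar j - tvar k) * q)"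
    if "1 \<le> j" "j < k" "k \<le> n" "v \<in> Sym n" and p: "\<forall>v\<in>Sym n. p v \<in> polys n" for j k v
  proof
    assume "tvar j - tvar k dvd p v - p (transpose j k \<circ> v)"
    then obtain q where q: "p v - p (transpose j k \<circ> v) = (tvar j - tvar k) * q" by (elim dvdE)
    have "transpose j k \<circ> v \<in> Sym n"
      using that by (intro Sym_comp Sym_transpose) auto
    then have "(tvar j - tvar k) * q \<in> polys n"
      using that by (simp flip: q add: polys_diff)
    then have "q \<in> polys n"
      by (rule polys_quotient) (use that in \<open>auto intro!: polys_diff\<close>)
    with q show "\<exists>q\<in>polys n. p v - p (transpose j k \<circ> v) = (tvar j - tvar k) * q" by blast
  qed auto
  then show ?thesis
    by (auto simp: HT_def gkm_def PiE_def Pi_def)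
qed

lemma gkm_polys: "gkm n p \<Longrightarrow> v \<in> Sym n \<Longrightarrow> p v \<in> polys n"
  by (simp add: gkm_def)

lemma gkm_ident:
  assumes "gkm n p" "v \<in> Sym n" "1 \<le> j" "j < k" "k \<le> n"
  shows "ident j k (p (transpose j k \<circ> v)) = ident j k (p v)"
proof -
  have "ident j k (p v - p (transpose j k \<circ> v)) = 0"
    using assms unfolding gkm_def diff_dvd_iff by blast
  then show ?thesis by (simp add: ident_def poly_subst_diff)
qed

lemma gkmI:
  assumes "\<And>v. v \<in> Sym n \<Longrightarrow> p v \<in> polys n"
    and "\<And>v j k. v \<in> Sym n \<Longrightarrow> 1 \<le> j \<Longrightarrow> j < k \<Longrightarrow> k \<le> n \<Longrightarrow>
      ident j k (p (transpose j k \<circ> v)) = ident j k (p v)"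
  shows "gkm n p"
  unfolding gkm_def diff_dvd_iff using assms by (auto simp: ident_def poly_subst_diff)

lemma gkm_cong:
  assumes "gkm n p" "\<And>v. v \<in> Sym n \<Longrightarrow> q v = p v"
  shows "gkm n q"
proof (rule gkmI)
  fix v j k assume *: "v \<in> Sym n" "1 \<le> j" "j < k" "k \<le> n"
  then have "transpose j k \<circ> v \<in> Sym n"
    by (intro Sym_comp Sym_transpose) auto
  then show "ident j k (q (transpose j k \<circ> v)) = ident j k (q v)"
    using gkm_ident[OF assms(1) *] assms(2) *(1) by simp
qed (use assms gkm_polys in auto)

lemma gkm_const: "c \<in> polys n \<Longrightarrow> gkm n (\<lambda>v. c)"
  by (rule gkmI) auto

lemma gkm_add: "gkm n p \<Longrightarrow> gkm n q \<Longrightarrow> gkm n (\<lambda>v. p v + q v)"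
  by (rule gkmI) (auto simp: gkm_polys gkm_ident[unfolded ident_def] ident_def poly_subst_add)

lemma gkm_diff: "gkm n p \<Longrightarrow> gkm n q \<Longrightarrow> gkm n (\<lambda>v. p v - q v)"
  by (rule gkmI) (auto simp: gkm_polys gkm_ident[unfolded ident_def] ident_def poly_subst_diff)

lemma gkm_mult: "gkm n p \<Longrightarrow> gkm n q \<Longrightarrow> gkm n (\<lambda>v. p v * q v)"
  by (rule gkmI) (auto simp: gkm_polys gkm_ident[unfolded ident_def] ident_def poly_subst_mult)

lemma gkm_sum: "(\<And>a. a \<in> A \<Longrightarrow> gkm n (f a)) \<Longrightarrow> gkm n (\<lambda>v. \<Sum>a\<in>A. f a v)"
  by (induction A rule: infinite_finite_induct) (auto simp: gkm_const gkm_add)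

lemma gkm_eq_0:
  assumes p: "gkm n p" and hom: "\<And>u. u \<in> Sym n \<Longrightarrow> homogeneous d (p u)"
    and small: "\<And>u. u \<in> Sym n \<Longrightarrow> len n u \<le> d \<Longrightarrow> p u = 0" and u: "u \<in> Sym n"
  shows "p u = 0"
  using u
proof (induction "len n u" arbitrary: u rule: less_induct)
  case less
  show ?case
  proof (cases "len n u \<le> d")
    case False
    let ?A = "inversions n u"
    have "(\<Prod>(a, b)\<in>?A. tvar a - tvar b) dvd p u"
    proof (rule prod_diff_dvd)
      fix a b assume ab: "(a, b) \<in> ?A"
      then have "moment_edge n u (transpose a b \<circ> u)"
        using less.prems by (auto simp: moment_edge_iff)
      then have "p (transpose a b \<circ> u) = 0"
        using less.hyps moment_edge_len moment_edge_Sym by blast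
      moreover have "tvar a - tvar b dvd p u - p (transpose a b \<circ> u)" "a < b"
        using ab p less.prems by (auto simp: gkm_def inversions_def)
      ultimately show "a < b \<and> tvar a - tvar b dvd p u" by simp
    qed simp
    then obtain q where q: "p u = (\<Prod>(a, b)\<in>?A. tvar a - tvar b) * q" by (elim dvdE)
    have "homogeneous d ((\<Prod>(a, b)\<in>?A. tvar a - tvar b) * q)"
      using hom[OF less.prems] q by simp
    then have "(\<Prod>(a, b)\<in>?A. tvar a - tvar b) * q = 0"
      using homogeneous_quotient_0[OF _ homogeneous_prod_diff[of ?A]] False
        len_eq_card_inversions[OF less.prems] by simp
    then show ?thesis using q by simp
  qed (use small less.prems in simp)
qed

section \<open>Schubert classes: uniqueness, divided differences, existence\<close>

definition is_schubert :: "nat \<Rightarrow> (nat \<Rightarrow> nat) \<Rightarrow> ((nat \<Rightarrow> nat) \<Rightarrow> cpoly) \<Rightarrow> bool" where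
  "is_schubert n w p \<longleftrightarrow> gkm n p \<and> (\<forall>u\<in>Sym n. \<not> bruhat_ge n u w \<longrightarrow> p u = 0) \<and>
     p w = (\<Prod>(j, k)\<in>inversions n w. tvar j - tvar k) \<and> (\<forall>u\<in>Sym n. homogeneous (len n w) (p u))"

lemma is_eq_schubert_iff:
  "w \<in> Sym n \<Longrightarrow> is_eq_schubert n w p \<longleftrightarrow> is_schubert n w p \<and> p \<in> extensional (Sym n)"
  unfolding is_eq_schubert_def is_schubert_def HT_carrier_iff inversions_eq_len by blast

lemma is_schubert_eq_0:
  assumes "is_schubert n w p" "u \<in> Sym n" "len n u \<le> len n w" "u \<noteq> w"
  shows "p u = 0"
  using assms bruhat_ge_cases[of n u w] moment_edge_len[of n u w] by (fastforce simp: is_schubert_def)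

lemma is_schubert_unique:
  assumes "is_schubert n w p" "is_schubert n w q" "u \<in> Sym n"
  shows "p u = q u"
proof -
  have "(\<lambda>v. p v - q v) u = 0"
  proof (rule gkm_eq_0[where d = "len n w" and p = "\<lambda>v. p v - q v"])
    fix v assume v: "v \<in> Sym n"
    show "homogeneous (len n w) (p v - q v)"
      using assms v by (auto simp: is_schubert_def intro: homogeneous_diff)
    show "p v - q v = 0" if "len n v \<le> len n w"
    proof (cases "v = w")
      case True
      then show ?thesis using assms(1,2) by (simp add: is_schubert_def)
    next
      case False
      then show ?thesis
        using is_schubert_eq_0[OF assms(1) v that] is_schubert_eq_0[OF assms(2) v that] by simp
    qed
  qed (use assms in \<open>auto simp: is_schubert_def intro: gkm_diff\<close>)
  then show ?thesis by simp
qed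

text \<open>The divisor is, up to sign, the label of the edge joining v and v s_i, so q exists
  pointwise. Its sign is such that at a descent w of i it is the factor of p_w(w) belonging to the
  inversion that w s_i loses.\<close>

lemma divided_difference:
  assumes p: "gkm n p" and i: "1 \<le> i" "i < n"
  obtains q where "gkm n q"
    and "\<And>v. v \<in> Sym n \<Longrightarrow> p v - p (v \<circ> simple_refl i) = (tvar (v (i + 1)) - tvar (v i)) * q v"
proof -
  let ?s = "simple_refl i" and ?\<alpha> = "\<lambda>v. tvar (v (i + 1)) - tvar (v i)"
  have s: "?s \<in> Sym n" using i by (intro Sym_transpose) auto
  have dvd: "?\<alpha> v dvd p v - p (v \<circ> ?s)" if v: "v \<in> Sym n" for v
  proof -
    have r: "1 \<le> v i" "v i \<le> n" "1 \<le> v (i + 1)" "v (i + 1) \<le> n"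
      using Sym_range[OF v] i by auto
    have ne: "v i \<noteq> v (i + 1)" using Sym_eq_iff[OF v] by simp
    show ?thesis
    proof (cases "v i < v (i + 1)")
      case True
      then have "tvar (v i) - tvar (v (i + 1)) dvd p v - p (v \<circ> ?s)"
        using p v r unfolding comp_transpose[OF v] gkm_def by blast
      then show ?thesis by (metis minus_diff_eq minus_dvd_iff)
    next
      case False
      then show ?thesis
        using p v r ne unfolding comp_transpose[OF v] gkm_def transpose_commute[of "v i"] by simp
    qed
  qed
  then obtain q where q: "\<And>v. v \<in> Sym n \<Longrightarrow> p v - p (v \<circ> ?s) = ?\<alpha> v * q v"
    unfolding dvd_def by metis
  have "gkm n q"
  proof (rule gkmI)
    fix v assume v: "v \<in> Sym n"
    have "p v - p (v \<circ> ?s) \<in> polys n"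
      by (rule polys_diff[OF gkm_polys[OF p v] gkm_polys[OF p Sym_comp[OF v s]]])
    then have "?\<alpha> v * q v \<in> polys n"
      unfolding q[OF v] .
    moreover have "?\<alpha> v \<in> polys n"
      using Sym_range[OF v] i by (intro polys_diff polys_tvar) auto
    moreover have "?\<alpha> v \<noteq> 0"
      using Sym_eq_iff[OF v] by simp
    ultimately show "q v \<in> polys n" by (rule polys_quotient)
    fix j k :: nat assume jk: "1 \<le> j" "j < k" "k \<le> n"
    let ?v' = "transpose j k \<circ> v"
    have v': "?v' \<in> Sym n" using v jk by (intro Sym_comp Sym_transpose) auto
    show "ident j k (q ?v') = ident j k (q v)"
    proof (cases "{v (i + 1), v i} = {j, k}")
      case True
      then have "transpose (v i) (v (i + 1)) = transpose j k"
        by (auto simp: doubleton_eq_iff transpose_commute)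
      \<comment> \<open>Here (j k) v = v s_i: numerator and divisor both change sign, and q has
        equal values at the two ends.\<close>
      then have v's: "?v' = v \<circ> ?s"
        using comp_transpose[OF v, of i "i + 1"] by simp
      then have v'ss: "?v' \<circ> ?s = v"
        by (simp add: comp_assoc)
      have "?v' (i + 1) = v i" "?v' i = v (i + 1)" unfolding v's by simp_all
      then have "- ?\<alpha> v * q ?v' = p ?v' - p (?v' \<circ> ?s)"
        unfolding q[OF v'] by (simp only: minus_diff_eq)
      also have "\<dots> = - (p v - p (v \<circ> ?s))" unfolding v'ss unfolding v's by simp
      also have "\<dots> = - ?\<alpha> v * q v" unfolding q[OF v] by (rule minus_mult_left)
      finally have "q ?v' = q v"
        using \<open>?\<alpha> v \<noteq> 0\<close> by (simp only: mult_cancel_left neg_equal_0_iff_equal simp_thms)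
      then show ?thesis by simp
    next
      case False
      \<comment> \<open>Otherwise the divisor survives modulo t_j - t_k. Numerators and divisors at
        v and (j k) v agree there, so the divisor can be cancelled.\<close>
      then have ne: "ident j k (?\<alpha> v) \<noteq> 0"
        using ident_diff_eq_0[of "v (i + 1)" "v i" j k] Sym_eq_iff[OF v] by auto
      have "ident j k (?\<alpha> v * q ?v') = ident j k (?\<alpha> ?v' * q ?v')"
        using ident_tvar_transpose[of j k] by (simp add: ident_def poly_subst_mult poly_subst_diff)
      also have "\<dots> = ident j k (p ?v' - p (?v' \<circ> ?s))"
        using q[OF v'] by simp
      also have "\<dots> = ident j k (p v - p (v \<circ> ?s))"
        using gkm_ident[OF p v jk] gkm_ident[OF p Sym_comp[OF v s] jk]
        by (simp add: ident_def poly_subst_diff comp_assoc)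
      also have "\<dots> = ident j k (?\<alpha> v * q v)"
        using q[OF v] by simp
      finally show ?thesis using ne by (simp add: ident_def poly_subst_mult)
    qed
  qed
  with q show ?thesis using that by blast
qed

text \<open>If q is nonzero at u, then u or u s_i lies above w, and either way u lies above w s_i by
  lifting. At w s_i the class p vanishes, so q is there p(w) divided by the form of the lost
  inversion.\<close>

lemma is_schubert_descend:
  assumes p: "is_schubert n w p" and w: "w \<in> Sym n" and i: "1 \<le> i" "i < n" "w (i + 1) < w i"
  shows "\<exists>q. is_schubert n (w \<circ> simple_refl i) q"
proof -
  let ?s = "simple_refl i"
  let ?w = "w \<circ> ?s"
  have s: "?s \<in> Sym n" using i by (intro Sym_transpose) auto
  have ss: "v \<circ> ?s \<circ> ?s = v" for v :: "nat \<Rightarrow> nat" by (simp add: comp_assoc)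
  have w': "?w \<in> Sym n" using w s by (rule Sym_comp)
  note edge = moment_edge_comp_simple[OF w i]
  have pp: "gkm n p" using p by (simp add: is_schubert_def)
  obtain q where q: "gkm n q"
    "\<And>v. v \<in> Sym n \<Longrightarrow> p v - p (v \<circ> ?s) = (tvar (v (i + 1)) - tvar (v i)) * q v"
    using divided_difference[OF pp i(1,2)] by blast
  have "is_schubert n ?w q"
    unfolding is_schubert_def
  proof (intro conjI ballI impI q(1))
    fix u assume u: "u \<in> Sym n"
    then have us: "u \<circ> ?s \<in> Sym n" using s by (rule Sym_comp)
    have ne: "tvar (u (i + 1)) - tvar (u i) \<noteq> 0" using Sym_eq_iff[OF u] by simp
    show "q u = 0" if no: "\<not> bruhat_ge n u ?w"
    proof -
      have "\<not> bruhat_ge n u w"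
        using no edge(1) unfolding bruhat_ge_def by (metis rtranclp.rtrancl_into_rtrancl)
      moreover have "\<not> bruhat_ge n (u \<circ> ?s) w"
        using no bruhat_ge_lift[OF _ i(1,2) edge(1), of "u \<circ> ?s"] unfolding ss by blast
      ultimately have "p u - p (u \<circ> ?s) = 0"
        using p u us by (simp add: is_schubert_def)
      then show ?thesis using q(2)[OF u] ne by simp
    qed
    have "homogeneous (len n w) (p u - p (u \<circ> ?s))"
      using p u us by (auto simp: is_schubert_def intro: homogeneous_diff)
    then have "homogeneous (len n ?w + 1) ((tvar (u (i + 1)) - tvar (u i)) * q u)"
      using q(2)[OF u] edge(2) by simp
    then show "homogeneous (len n ?w) (q u)"
      by (rule homogeneous_quotient) (use ne homogeneous_diff homogeneous_tvar in auto)
  next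
    have "?w \<noteq> w" using edge(2) by auto
    then have "p ?w = 0" using is_schubert_eq_0[OF p w'] edge(2) by simp
    then have "(tvar (w i) - tvar (w (i + 1))) * q ?w = - p w"
      using q(2)[OF w'] unfolding ss by simp
    also have "p w = (tvar (w (i + 1)) - tvar (w i)) * (\<Prod>(j, k)\<in>inversions n ?w. tvar j - tvar k)"
      using p inversions_comp_simple[OF w i]
      by (simp add: is_schubert_def prod.remove[of "inversions n w" "(w (i + 1), w i)"])
    finally have "(tvar (w i) - tvar (w (i + 1))) * q ?w =
        (tvar (w i) - tvar (w (i + 1))) * (\<Prod>(j, k)\<in>inversions n ?w. tvar j - tvar k)"
      by (simp only: minus_mult_left minus_diff_eq)
    moreover have "tvar (w i) - tvar (w (i + 1)) \<noteq> 0" using i(3) by simp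
    ultimately show "q ?w = (\<Prod>(j, k)\<in>inversions n ?w. tvar j - tvar k)" by simp
  qed
  then show ?thesis by blast
qed

lemma is_schubert_exists:
  assumes "w \<in> Sym n"
  shows "\<exists>p. is_schubert n w p"
  using assms
\<comment> \<open>The measure is the distance from the longest element: at an ascent i of w the
  class of the longer w s_i is available and can be descended.\<close>
proof (induction "card {(a, b). 1 \<le> a \<and> a < b \<and> b \<le> n} - len n w" arbitrary: w rule: less_induct)
  case less
  let ?all = "{(a, b). 1 \<le> a \<and> a < b \<and> b \<le> n}"
  have fin: "finite ?all" by (rule finite_subset[of _ "{1..n} \<times> {1..n}"]) auto
  show ?case
  proof (cases "\<exists>i. 1 \<le> i \<and> i < n \<and> w i < w (i + 1)")
    case True
    then obtain i where i: "1 \<le> i" "i < n" "w i < w (i + 1)" by blast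
    let ?w = "w \<circ> simple_refl i"
    have w': "?w \<in> Sym n" using less.prems i by (intro Sym_comp Sym_transpose) auto
    have desc: "?w (i + 1) < ?w i" using i by simp
    have ww: "?w \<circ> simple_refl i = w" by (simp add: comp_assoc)
    have "len n ?w = Suc (len n w)"
      using moment_edge_comp_simple(2)[OF w' i(1,2) desc] unfolding ww .
    moreover have "card (inversions n ?w) \<le> card ?all"
      by (rule card_mono[OF fin]) (auto simp: inversions_def)
    ultimately have "card ?all - len n ?w < card ?all - len n w"
      using len_eq_card_inversions[OF w'] by simp
    then obtain p where "is_schubert n ?w p" using less.hyps w' by blast
    then show ?thesis using is_schubert_descend[OF _ w' i(1,2) desc] unfolding ww by blast
  next
    case False
    have "w (i + 1) < w i" if "1 \<le> i" "i < n" for i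
      using False that Sym_eq_iff[OF less.prems, of i "i + 1"] by (metis n_not_Suc_n Suc_eq_plus1 linorder_neqE_nat)
    then have inv: "inversions n w = ?all"
      using descending_inversions[OF less.prems] by blast
    let ?e = "\<Prod>(j, k)\<in>?all. tvar j - tvar k"
    let ?p = "\<lambda>u. if u = w then ?e else 0"
    \<comment> \<open>At the longest element the value contains every form t_j - t_k, so it vanishes
      modulo each of them and all GKM conditions hold.\<close>
    have ident: "ident j k (?p u) = 0" if "1 \<le> j" "j < k" "k \<le> n" for j k u
    proof -
      have "ident j k ?e = 0"
        unfolding ident_def poly_subst_prod
        by (rule prod_zero[OF fin], rule bexI[of _ "(j, k)"]) (use that in \<open>auto simp: poly_subst_diff\<close>)
      then show ?thesis by (simp add: ident_def)
    qed
    have "is_schubert n w ?p"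
      unfolding is_schubert_def
    proof (intro conjI ballI impI)
      show "gkm n ?p"
        by (rule gkmI) (auto simp: ident intro!: polys_prod polys_diff)
      show "?p u = 0" if "\<not> bruhat_ge n u w" for u
        using that by (auto simp: bruhat_ge_def)
      show "homogeneous (len n w) (?p u)" for u
        using homogeneous_prod_diff[OF fin] by (simp add: len_eq_card_inversions[OF less.prems] inv)
    qed (simp add: inv)
    then show ?thesis by blast
  qed
qed

section \<open>The class of a simple reflection\<close>

definition fund :: "nat \<Rightarrow> (nat \<Rightarrow> nat) \<Rightarrow> cpoly" where
  "fund i u = (\<Sum>a = 1..i. tvar a - tvar (u a))"

text \<open>Only the set of values in the first i positions matters, so the sum changes exactly when
  one of the swapped positions is at most i and the other beyond. This is the origin of the
  condition j \<le> i < k in the formula.\<close>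

lemma fund_transpose:
  assumes "1 \<le> a" "a < b"
  shows "fund i (u \<circ> transpose a b) = fund i u + (if a \<le> i \<and> i < b then tvar (u a) - tvar (u b) else 0)"
proof -
  let ?f = "\<lambda>x. tvar (u x)"
  have eq: "(\<Sum>x = 1..i. tvar (u (transpose a b x))) =
      (\<Sum>x = 1..i. tvar (u x)) - (if a \<le> i \<and> i < b then tvar (u a) - tvar (u b) else 0)"
  proof (cases "a \<le> i")
    case True
    show ?thesis
    proof (cases "b \<le> i")
      case True
      have "transpose a b permutes {1..i}"
        using True assms by (intro permutes_swap_id) auto
      from sum.permute[OF this, of ?f] show ?thesis using True by (simp add: o_def)
    next
      case False
      have "(\<Sum>x\<in>{1..i} - {a}. tvar (u (transpose a b x))) = (\<Sum>x\<in>{1..i} - {a}. tvar (u x))"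
        by (rule sum.cong) (use False in \<open>auto simp: transpose_def\<close>)
      then show ?thesis
        using True False assms sum.remove[of "{1..i}" a "\<lambda>x. tvar (u (transpose a b x))"]
          sum.remove[of "{1..i}" a ?f] by simp
    qed
  next
    case False
    have "(\<Sum>x = 1..i. tvar (u (transpose a b x))) = (\<Sum>x = 1..i. tvar (u x))"
      by (rule sum.cong) (use False assms in \<open>auto simp: transpose_def\<close>)
    then show ?thesis using False by simp
  qed
  show ?thesis
    unfolding fund_def sum_subtractf comp_apply eq by simp
qed

lemma gkm_fund:
  assumes "i \<le> n"
  shows "gkm n (fund i)"
proof (rule gkmI)
  fix v assume v: "v \<in> Sym n"
  show "fund i v \<in> polys n"
    unfolding fund_def using assms Sym_range[OF v] by (intro polys_sum polys_diff polys_tvar) auto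
  show "ident j k (fund i (transpose j k \<circ> v)) = ident j k (fund i v)" for j k
    using ident_tvar_transpose[of j k]
    by (simp add: fund_def ident_def poly_subst_sum poly_subst_diff)
qed

lemma homogeneous_fund: "homogeneous 1 (fund i u)"
  unfolding fund_def by (intro homogeneous_sum homogeneous_diff homogeneous_tvar)

lemma inversions_simple:
  assumes "1 \<le> i" "i < n"
  shows "inversions n (simple_refl i) = {(i, i + 1)}"
proof -
  have s: "simple_refl i \<in> Sym n" using assms by (intro Sym_transpose) auto
  have "inversions n id = {}" by (auto simp: inversions_def)
  moreover have "simple_refl i \<circ> simple_refl i = id" by simp
  ultimately show ?thesis
    using inversions_comp_simple[OF s assms] by auto
qed

lemma transpose_inj_pair:
  fixes a b :: nat
  assumes "transpose a b = transpose c d" "a < b" "c < d"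
  shows "a = c \<and> b = d"
proof -
  have "transpose c d a = b" using assms(1) transpose_apply_first[of a b] by simp
  then show ?thesis using assms(2,3) by (auto simp: transpose_def split: if_splits)
qed

text \<open>The degree principle with d = 1 reduces the comparison to words of at most one letter:
  both sides are 0 at the identity and at s_j for j different from i, and t_i - t_{i+1} at
  s_i.\<close>

lemma is_schubert_simple:
  assumes i: "1 \<le> i" "i < n" and p: "is_schubert n (simple_refl i) p" and u: "u \<in> Sym n"
  shows "p u = fund i u"
proof -
  have s: "simple_refl j \<in> Sym n" "len n (simple_refl j) = 1" if "1 \<le> j" "j < n" for j
  proof -
    show s: "simple_refl j \<in> Sym n" using that by (intro Sym_transpose) auto
    show "len n (simple_refl j) = 1"
      using inversions_simple[OF that] unfolding len_eq_card_inversions[OF s] by simp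
  qed
  have fund: "fund i (simple_refl j) = (if j = i then tvar i - tvar (i + 1) else 0)" if "1 \<le> j" for j
    using fund_transpose[of j "j + 1" i id] that by (auto simp: fund_def)
  have "(\<lambda>v. p v - fund i v) u = 0"
  proof (rule gkm_eq_0[where d = 1 and p = "\<lambda>v. p v - fund i v"])
    show "gkm n (\<lambda>v. p v - fund i v)"
      using p gkm_fund[of i n] i by (intro gkm_diff) (auto simp: is_schubert_def)
    fix v assume v: "v \<in> Sym n"
    show "homogeneous 1 (p v - fund i v)"
      using p v s(2)[OF i] homogeneous_fund[of i v] by (intro homogeneous_diff) (auto simp: is_schubert_def)
    show "p v - fund i v = 0" if len: "len n v \<le> 1"
    proof -
      obtain "is" where "is": "length is \<le> card (inversions n v)" "set is \<subseteq> {1..<n}" "v = word_perm is"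
        using word_perm_exists[OF v] by blast
      have "length is \<le> 1" using "is"(1) len len_eq_card_inversions[OF v] by simp
      with "is" consider "v = id" | j where "v = simple_refl j" "1 \<le> j" "j < n"
        by (cases "is") auto
      then show ?thesis
      proof cases
        case 1
        have "id \<noteq> simple_refl i" by (auto simp: fun_eq_iff transpose_def)
        then have "p v = 0"
          using is_schubert_eq_0[OF p v] len s(2)[OF i] 1 by simp
        then show ?thesis using 1 by (simp add: fund_def)
      next
        case (2 j)
        show ?thesis
        proof (cases "j = i")
          case True
          then show ?thesis
            using p 2 fund[of j] inversions_simple[OF i] by (simp add: is_schubert_def)
        next
          case False
          then have "simple_refl j \<noteq> simple_refl i"
            using transpose_inj_pair[of j "j + 1" i "i + 1"] by auto
          then have "p v = 0"
            using is_schubert_eq_0[OF p v] len s(2)[OF i] 2 by simp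
          then show ?thesis using fund[of j] 2 False by simp
        qed
      qed
    qed
  qed (rule u)
  then show ?thesis by simp
qed

section \<open>Values at covers and the equivariant formula\<close>

lemma ident_pair_swap:
  "ident j k (case pair_swap j k p of (a, b) \<Rightarrow> tvar a - tvar b) = ident j k (case p of (a, b) \<Rightarrow> tvar a - tvar b)"
  using ident_tvar_transpose[of j k]
  by (auto simp: pair_swap_def ident_def poly_subst_diff split: prod.splits)

text \<open>At a cover \<open>u\<close> of \<open>w\<close> the value \<open>p u\<close> is a constant times the product over all
  inversions of \<open>u\<close> but \<open>(j, k)\<close>; comparing with \<open>p w\<close> modulo \<open>tvar j - tvar k\<close> shows that
  the constant is 1.\<close>

lemma is_schubert_cover:
  assumes p: "is_schubert n w p" and u: "u \<in> Sym n" and jk: "(j, k) \<in> inversions n u"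
    and w: "w = transpose j k \<circ> u" and len: "len n u = len n w + 1"
  shows "(tvar j - tvar k) * p u = (\<Prod>(a, b)\<in>inversions n u. tvar a - tvar b)"
proof -
  let ?B = "inversions n u - {(j, k)}"
  let ?\<Pi> = "\<lambda>A. \<Prod>(a, b)\<in>A. tvar a - tvar b"
  have jk': "1 \<le> j" "j < k" "k \<le> n" "winv u k < winv u j" using jk by (auto simp: inversions_def)
  have wS: "w \<in> Sym n" unfolding w using u jk' by (intro Sym_comp Sym_transpose) auto
  have uw: "u = transpose j k \<circ> w" unfolding w by (simp add: comp_assoc[symmetric])
  have p': "gkm n p" using p by (simp add: is_schubert_def)
  have wjk: "winv w j < winv w k" using jk' by (simp add: w inv_transpose_comp[OF u])
  have cardB: "card ?B = len n w"
    using jk len by (simp add: len_eq_card_inversions[OF u])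
  \<comment> \<open>Every other edge from u ends at an element different from w of length at most
    \<open>len n w\<close>, where p vanishes.\<close>
  have "?\<Pi> ?B dvd p u"
  proof (rule prod_diff_dvd)
    fix a b assume ab: "(a, b) \<in> ?B"
    then have ab': "1 \<le> a" "a < b" "b \<le> n" by (auto simp: inversions_def)
    have e: "moment_edge n u (transpose a b \<circ> u)"
      using ab u by (auto simp: moment_edge_iff)
    have "transpose a b \<noteq> transpose j k"
      using transpose_inj_pair[of a b j k] ab ab' jk' by blast
    then have "transpose a b \<circ> u \<noteq> w"
      unfolding w by (metis comp_assoc comp_id bij_is_surj surj_iff Sym_bij[OF u])
    then have "p (transpose a b \<circ> u) = 0"
      using is_schubert_eq_0[OF p moment_edge_Sym[OF e]] moment_edge_len[OF e] len by simp
    then show "a < b \<and> tvar a - tvar b dvd p u"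
      using p' u ab' by (metis gkm_def diff_zero)
  qed simp
  then obtain c where c: "p u = ?\<Pi> ?B * c" by (elim dvdE)
  have nz: "ident j k (?\<Pi> ?B) \<noteq> 0"
  proof
    assume "ident j k (?\<Pi> ?B) = 0"
    then have "\<exists>(a, b)\<in>?B. ident j k (tvar a - tvar b) = 0"
      by (auto simp: ident_def poly_subst_prod split_beta)
    then obtain a b where ab: "(a, b) \<in> ?B" "ident j k (tvar a - tvar b) = 0" by blast
    then have "a < b" by (auto simp: inversions_def)
    then show False
      using ident_diff_eq_0[of a b j k] ab jk' by (auto simp: doubleton_eq_iff)
  qed
  \<comment> \<open>The summand 0 is the degree of the cofactor c, in the shape expected by
    \<open>homogeneous_quotient\<close>.\<close>
  have "homogeneous (0 + len n w) (p u)"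
    using p u by (simp add: is_schubert_def)
  then have "homogeneous (0 + len n w) (?\<Pi> ?B * c)"
    unfolding c .
  moreover have "homogeneous (len n w) (?\<Pi> ?B)"
    using homogeneous_prod_diff[of ?B] cardB by simp
  moreover have "?\<Pi> ?B \<noteq> 0" using nz by (metis ident_def poly_subst_0)
  ultimately have "homogeneous 0 c" by (rule homogeneous_quotient)
  then obtain z where z: "c = poly_const z" by (rule homogeneous_0_const)
  \<comment> \<open>Since u has just one inversion more than w, the injection is onto. The factors
    at w and those in \<open>?B\<close> then match one by one modulo t_j - t_k.\<close>
  have "pair_swap j k ` inversions n w = ?B"
  proof (rule card_subset_eq)
    show "pair_swap j k ` inversions n w \<subseteq> ?B"
      using pair_swap_inversions[OF wS jk'(1-3) wjk] unfolding uw[symmetric] .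
    show "card (pair_swap j k ` inversions n w) = card ?B"
      using cardB by (simp add: card_image pair_swap_inj jk' len_eq_card_inversions[OF wS])
  qed simp
  then have "ident j k (?\<Pi> ?B) = ident j k (?\<Pi> (pair_swap j k ` inversions n w))" by simp
  also have "\<dots> = (\<Prod>x\<in>inversions n w. ident j k (case pair_swap j k x of (a, b) \<Rightarrow> tvar a - tvar b))"
    by (simp add: ident_def poly_subst_prod prod.reindex pair_swap_inj jk')
  also have "\<dots> = ident j k (?\<Pi> (inversions n w))"
    unfolding ident_pair_swap by (simp add: ident_def poly_subst_prod)
  also have "\<dots> = ident j k (p w)"
    using p by (simp add: is_schubert_def)
  also have "\<dots> = ident j k (p u)"
    using gkm_ident[OF p' u jk'(1-3)] w by simp
  also have "\<dots> = ident j k (?\<Pi> ?B) * c"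
    unfolding c z by (simp add: ident_def poly_subst_mult)
  finally have "c = 1" using nz by simp
  then show ?thesis
    using c jk by (simp add: prod.remove[of "inversions n u" "(j, k)"])
qed

text \<open>Up to length \<open>len n w + 1\<close> only w and its covers need a check. At w the
  factor \<open>fund i v - fund i w\<close> is zero. At a cover it is the label of the edge if i
  separates the swapped positions, and \<open>is_schubert_cover\<close> turns the product into
  p_v(v), the only surviving summand; otherwise both parts vanish.\<close>

lemma equivariant_chevalley:
  assumes i: "1 \<le> i" "i < n" and w: "w \<in> Sym n"
    and P: "\<And>v. v \<in> Sym n \<Longrightarrow> is_schubert n v (P v)" and u: "u \<in> Sym n"
  defines "S \<equiv> {(j, k). 1 \<le> j \<and> j \<le> i \<and> i + 1 \<le> k \<and> k \<le> n \<and> len n (w \<circ> transpose j k) = len n w + 1}"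
  shows "fund i u * P w u = fund i w * P w u + (\<Sum>(j, k)\<in>S. P (w \<circ> transpose j k) u)"
proof -
  let ?d = "len n w + 1"
  have S: "w \<circ> transpose j k \<in> Sym n" "len n (w \<circ> transpose j k) = ?d" "1 \<le> j" "j < k" "j \<le> i" "i < k" "k \<le> n"
    if "(j, k) \<in> S" for j k
    using that w by (auto simp: S_def intro!: Sym_comp Sym_transpose)
  have finS: "finite S"
    by (rule finite_subset[of _ "{1..n} \<times> {1..n}"]) (auto simp: S_def)
  have edgeS: "moment_edge n (w \<circ> transpose j k) w" if "(j, k) \<in> S" for j k
  proof -
    note s = S[OF that]
    have "w = w \<circ> transpose j k \<circ> transpose j k" by (simp add: comp_assoc)
    also have "\<dots> = transpose (w k) (w j) \<circ> (w \<circ> transpose j k)"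
      using comp_transpose[OF s(1), of j k] by simp
    finally have eq: "w = transpose (w k) (w j) \<circ> (w \<circ> transpose j k)" .
    have r: "1 \<le> w j" "w j \<le> n" "1 \<le> w k" "w k \<le> n" using Sym_range[OF w] s by auto
    have "w j \<noteq> w k" using Sym_eq_iff[OF w] s by simp
    then show ?thesis
      unfolding moment_edge_def using eq r s by (metis less_add_one linorder_neqE_nat transpose_commute)
  qed
  let ?D = "\<lambda>v. (fund i v - fund i w) * P w v - (\<Sum>x\<in>S. (case x of (j, k) \<Rightarrow> P (w \<circ> transpose j k)) v)"
  have "?D u = 0"
  proof (rule gkm_eq_0[where d = ?d and p = ?D])
    show "gkm n ?D"
    proof -
      have n: "i \<le> n" using i by simp
      have Pw: "gkm n (P v)" if "v \<in> Sym n" for v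
        using P[OF that] by (simp add: is_schubert_def)
      have "gkm n (\<lambda>v. fund i v - fund i w)"
        by (rule gkm_diff[OF gkm_fund[OF n] gkm_const[OF gkm_polys[OF gkm_fund[OF n] w]]])
      from gkm_mult[OF this Pw[OF w]] have "gkm n (\<lambda>v. (fund i v - fund i w) * P w v)" .
      moreover have "gkm n (\<lambda>v. \<Sum>x\<in>S. (case x of (j, k) \<Rightarrow> P (w \<circ> transpose j k)) v)"
        by (rule gkm_sum) (use Pw[OF S(1)] in auto)
      ultimately show ?thesis by (rule gkm_diff)
    qed
    fix v assume v: "v \<in> Sym n"
    have "homogeneous (1 + len n w) ((fund i v - fund i w) * P w v)"
      using P[OF w] v
      by (intro homogeneous_mult[OF homogeneous_diff[OF homogeneous_fund homogeneous_fund]]) (simp add: is_schubert_def)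
    moreover have "homogeneous ?d (\<Sum>x\<in>S. (case x of (j, k) \<Rightarrow> P (w \<circ> transpose j k)) v)"
    proof (rule homogeneous_sum, clarify)
      fix j k assume "(j, k) \<in> S"
      then show "homogeneous ?d (P (w \<circ> transpose j k) v)"
        using P[OF S(1)] S(2) v unfolding is_schubert_def by metis
    qed
    ultimately show "homogeneous ?d (?D v)"
      by (intro homogeneous_diff) (simp_all add: add.commute)
    show "?D v = 0" if len: "len n v \<le> ?d"
    proof -
      have other: "P (w \<circ> transpose j k) v = 0" if "(j, k) \<in> S" "v \<noteq> w \<circ> transpose j k" for j k
        using is_schubert_eq_0[OF P[OF S(1)[OF that(1)]] v] S(2)[OF that(1)] len that(2) by simp
      have zero: "(\<Sum>x\<in>S. (case x of (j, k) \<Rightarrow> P (w \<circ> transpose j k)) v) = 0"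
        if "\<And>j k. (j, k) \<in> S \<Longrightarrow> v \<noteq> w \<circ> transpose j k"
        by (rule sum.neutral) (use that other in auto)
      consider "\<not> bruhat_ge n v w" | "v = w" | "moment_edge n v w"
        using bruhat_ge_cases[of n v w] len by fastforce
      then show ?thesis
      proof cases
        case 1
        then have "P w v = 0" using P[OF w] v by (simp add: is_schubert_def)
        moreover have "v \<noteq> w \<circ> transpose j k" if "(j, k) \<in> S" for j k
          using 1 edgeS[OF that] unfolding bruhat_ge_def by auto
        ultimately show ?thesis using zero by simp
      next
        case 2
        have "v \<noteq> w \<circ> transpose j k" if "(j, k) \<in> S" for j k
          using S(2)[OF that] 2 by fastforce
        then show ?thesis using 2 zero by simp
      next
        case 3
        then obtain j k where jk: "(j, k) \<in> inversions n v" "w = transpose j k \<circ> v"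
          by (auto simp: moment_edge_iff)
        have lenv: "len n v = ?d" using moment_edge_len[OF 3] len by simp
        \<comment> \<open>The edge names the exchanged values, the sum is indexed by positions; a
          and b are the positions of j and k in w.\<close>
        define a b where "a = winv w j" and "b = winv w k"
        have jk': "1 \<le> j" "j < k" "k \<le> n" "winv v k < winv v j" using jk by (auto simp: inversions_def)
        have ab: "a < b" using jk'(4) unfolding a_def b_def jk(2) by (simp add: inv_transpose_comp[OF v])
        have r: "1 \<le> a" "b \<le> n"
          using Sym_range[OF Sym_inv[OF w]] jk' by (auto simp: a_def b_def)
        have wab: "w a = j" "w b = k" using w by (auto simp: a_def b_def)
        have "v = transpose j k \<circ> w"
          unfolding jk(2) by (simp add: comp_assoc[symmetric])
        then have vw: "v = w \<circ> transpose a b"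
          using comp_transpose[OF w, of a b] wab by simp
        have fund: "fund i v - fund i w = (if a \<le> i \<and> i < b then tvar j - tvar k else 0)"
          using fund_transpose[OF r(1) ab, of i w] wab vw by simp
        \<comment> \<open>Cancelling w shows that at most one summand is supported at v.\<close>
        have uniq: "(c, d) = (a, b)" if "v = w \<circ> transpose c d" "c < d" for c d
        proof -
          have "transpose c d = transpose a b"
            using that(1) vw Sym_eq_iff[OF w] by (auto simp: fun_eq_iff)
          then show ?thesis using transpose_inj_pair that(2) ab by blast
        qed
        show ?thesis
        proof (cases "a \<le> i \<and> i < b")
          case True
          then have abS: "(a, b) \<in> S"
            using r lenv vw by (simp add: S_def)
          have "(\<Sum>x\<in>S - {(a, b)}. (case x of (j, k) \<Rightarrow> P (w \<circ> transpose j k)) v) = 0"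
          proof (rule sum.neutral, rule ballI)
            fix x assume "x \<in> S - {(a, b)}"
            moreover obtain c d where "x = (c, d)" by (cases x)
            ultimately show "(case x of (j, k) \<Rightarrow> P (w \<circ> transpose j k)) v = 0"
              using uniq[of c d] other[of c d] S(4)[of c d] by auto
          qed
          then have "(\<Sum>x\<in>S. (case x of (j, k) \<Rightarrow> P (w \<circ> transpose j k)) v) = P v v"
            unfolding sum.remove[OF finS abS] by (simp only: add_0_right prod.case vw[symmetric])
          also have "\<dots> = (tvar j - tvar k) * P w v"
            using is_schubert_cover[OF P[OF w] v jk lenv] P[OF v] by (simp add: is_schubert_def)
          finally show ?thesis using fund True by simp
        next
          case False
          have "v \<noteq> w \<circ> transpose c d" if "(c, d) \<in> S" for c d
            using uniq[of c d] S(4-6)[OF that] False by blast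
          then show ?thesis using fund False zero by simp
        qed
      qed
    qed
  qed (rule u)
  then show ?thesis
    by (simp add: algebra_simps split_beta)
qed

subsection \<open>The ring of GKM classes\<close>

lemma restrict_in_HT: "gkm n p \<Longrightarrow> restrict p (Sym n) \<in> carrier (HT n)"
  unfolding HT_carrier_iff by (auto intro: gkm_cong)

lemma HT_gkm: "p \<in> carrier (HT n) \<Longrightarrow> gkm n p"
  by (simp add: HT_carrier_iff)

lemma HT_eqI:
  assumes "p \<in> carrier (HT n)" "q \<in> carrier (HT n)" "\<And>v. v \<in> Sym n \<Longrightarrow> p v = q v"
  shows "p = q"
  using assms by (auto simp: HT_carrier_iff intro: extensionalityI)

lemma HT_simps:
  "p \<otimes>\<^bsub>HT n\<^esub> q = (\<lambda>v\<in>Sym n. p v * q v)" "\<one>\<^bsub>HT n\<^esub> = (\<lambda>v\<in>Sym n. 1)"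
  "p \<oplus>\<^bsub>HT n\<^esub> q = (\<lambda>v\<in>Sym n. p v + q v)" "\<zero>\<^bsub>HT n\<^esub> = (\<lambda>v\<in>Sym n. 0)"
  by (simp_all add: HT_def)

lemma HT_mult_closed:
  "p \<in> carrier (HT n) \<Longrightarrow> q \<in> carrier (HT n) \<Longrightarrow> p \<otimes>\<^bsub>HT n\<^esub> q \<in> carrier (HT n)"
  unfolding HT_simps by (rule restrict_in_HT[OF gkm_mult[OF HT_gkm HT_gkm]])

lemma HT_add_closed:
  "p \<in> carrier (HT n) \<Longrightarrow> q \<in> carrier (HT n) \<Longrightarrow> p \<oplus>\<^bsub>HT n\<^esub> q \<in> carrier (HT n)"
  unfolding HT_simps by (rule restrict_in_HT[OF gkm_add[OF HT_gkm HT_gkm]])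

lemma HT_one_closed: "\<one>\<^bsub>HT n\<^esub> \<in> carrier (HT n)"
  unfolding HT_simps by (rule restrict_in_HT[OF gkm_const[OF polys_1]])

lemma HT_zero_closed: "\<zero>\<^bsub>HT n\<^esub> \<in> carrier (HT n)"
  unfolding HT_simps by (rule restrict_in_HT[OF gkm_const[OF polys_0]])

lemmas HT_closed = HT_mult_closed HT_add_closed HT_one_closed HT_zero_closed

lemma cring_HT: "cring (HT n)"
proof (rule cringI)
  show "abelian_group (HT n)"
  proof (rule abelian_groupI)
    fix x assume x: "x \<in> carrier (HT n)"
    have "gkm n (\<lambda>v. - x v)"
      using gkm_diff[OF gkm_const[OF polys_0] HT_gkm[OF x]] by simp
    then have "(\<lambda>v\<in>Sym n. - x v) \<in> carrier (HT n)" by (rule restrict_in_HT)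
    moreover have "(\<lambda>v\<in>Sym n. - x v) \<oplus>\<^bsub>HT n\<^esub> x = \<zero>\<^bsub>HT n\<^esub>"
      by (auto simp: HT_simps intro: restrict_ext)
    ultimately show "\<exists>y\<in>carrier (HT n). y \<oplus>\<^bsub>HT n\<^esub> x = \<zero>\<^bsub>HT n\<^esub>" by blast
  qed (auto intro!: HT_closed HT_eqI[of _ n], auto simp: HT_simps add_ac)
  show "comm_monoid (HT n)"
    by (rule comm_monoidI) (auto intro!: HT_closed HT_eqI[of _ n], auto simp: HT_simps mult_ac)
next
  fix x y z
  assume "x \<in> carrier (HT n)" "y \<in> carrier (HT n)" "z \<in> carrier (HT n)"
  then show "(x \<oplus>\<^bsub>HT n\<^esub> y) \<otimes>\<^bsub>HT n\<^esub> z = x \<otimes>\<^bsub>HT n\<^esub> z \<oplus>\<^bsub>HT n\<^esub> y \<otimes>\<^bsub>HT n\<^esub> z"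
    by (intro HT_eqI[of _ n] HT_closed) (auto simp: HT_simps distrib_right)
qed

lemma finsum_HT:
  assumes "finite A" "\<And>a. a \<in> A \<Longrightarrow> f a \<in> carrier (HT n)"
  shows "finsum (HT n) f A = (\<lambda>v\<in>Sym n. \<Sum>a\<in>A. f a v)"
proof -
  interpret cring "HT n" by (rule cring_HT)
  show ?thesis
    using assms
  proof (induction A)
    case empty
    then show ?case by (simp add: HT_simps)
  next
    case (insert a A)
    then have "f \<in> A \<rightarrow> carrier (HT n)" "f a \<in> carrier (HT n)" by auto
    then have "finsum (HT n) f (insert a A) = f a \<oplus>\<^bsub>HT n\<^esub> finsum (HT n) f A"
      by (rule finsum_insert[OF insert.hyps])
    then show ?case
      using insert by (auto simp: HT_simps intro: restrict_ext)
  qed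
qed

section \<open>The augmentation ideal and passage to ordinary cohomology\<close>

lemma const_tvar_in_HT: "1 \<le> a \<Longrightarrow> a \<le> n \<Longrightarrow> (\<lambda>v\<in>Sym n. tvar a) \<in> carrier (HT n)"
  by (intro restrict_in_HT gkm_const polys_tvar)

lemma ideal_aug: "ideal (aug_ideal n) (HT n)"
proof -
  interpret cring "HT n" by (rule cring_HT)
  show ?thesis
    unfolding aug_ideal_def by (rule genideal_ideal) (use const_tvar_in_HT in auto)
qed

lemma tvar_mult_in_aug_ideal:
  assumes "1 \<le> a" "a \<le> n" "gkm n p"
  shows "(\<lambda>v\<in>Sym n. tvar a * p v) \<in> aug_ideal n"
proof -
  interpret cring "HT n" by (rule cring_HT)
  interpret I: ideal "aug_ideal n" "HT n" by (rule ideal_aug)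
  have "(\<lambda>v\<in>Sym n. tvar a) \<in> aug_ideal n"
    unfolding aug_ideal_def
    by (rule subsetD[OF genideal_self]) (use const_tvar_in_HT assms(1,2) in auto)
  then have "(\<lambda>v\<in>Sym n. tvar a) \<otimes>\<^bsub>HT n\<^esub> restrict p (Sym n) \<in> aug_ideal n"
    by (rule I.I_r_closed) (rule restrict_in_HT[OF assms(3)])
  moreover have "(\<lambda>v\<in>Sym n. tvar a) \<otimes>\<^bsub>HT n\<^esub> restrict p (Sym n) = (\<lambda>v\<in>Sym n. tvar a * p v)"
    by (auto simp: HT_simps intro: restrict_ext)
  ultimately show ?thesis by simp
qed

text \<open>With w fixed, \<open>fund i w\<close> is a linear form that does not depend on v, hence
  acts as a scalar from the augmentation ideal; its differences are peeled off one at a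
  time.\<close>

lemma fund_mult_in_aug_ideal:
  assumes w: "w \<in> Sym n" and "i \<le> n" and p: "gkm n p"
  shows "(\<lambda>v\<in>Sym n. fund i w * p v) \<in> aug_ideal n"
proof -
  interpret I: ideal "aug_ideal n" "HT n" by (rule ideal_aug)
  note closed = additive_subgroup.a_closed[OF ideal.axioms(1)[OF ideal_aug]]
  show ?thesis
    using assms(2)
  proof (induction i)
    case 0
    have "(\<lambda>v\<in>Sym n. fund 0 w * p v) = \<zero>\<^bsub>HT n\<^esub>"
      by (simp add: fund_def HT_simps)
    then show ?case by simp
  next
    case (Suc i)
    let ?f = "\<lambda>v\<in>Sym n. fund i w * p v"
    let ?g = "\<lambda>v\<in>Sym n. tvar (Suc i) * p v"
    \<comment> \<open>The sign goes into the class: \<open>- p\<close> satisfies the GKM conditions,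
      so this is again a variable times a class.\<close>
    let ?h = "\<lambda>v\<in>Sym n. tvar (w (Suc i)) * - p v"
    have "gkm n (\<lambda>v. - p v)"
      using gkm_diff[OF gkm_const[OF polys_0] p] by simp
    then have h: "?h \<in> aug_ideal n"
      using Sym_range[OF w, of "Suc i"] Suc.prems by (intro tvar_mult_in_aug_ideal) auto
    have g: "?g \<in> aug_ideal n"
      using Suc.prems p by (intro tvar_mult_in_aug_ideal) auto
    have f: "?f \<in> aug_ideal n"
      using Suc.prems by (intro Suc.IH) simp
    have "?f \<oplus>\<^bsub>HT n\<^esub> (?g \<oplus>\<^bsub>HT n\<^esub> ?h) = (\<lambda>v\<in>Sym n. fund (Suc i) w * p v)"
      by (auto simp: HT_simps fund_def algebra_simps intro!: restrict_ext)
    then show ?case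
      using closed[OF f closed[OF g h]] by (simp only:)
  qed
qed

text \<open>Restricting a solution to \<open>Sym n\<close> makes it extensional, and agreement on
  \<open>Sym n\<close> is then equality, so the definite description is meaningful.\<close>

lemma eq_schubert:
  assumes w: "w \<in> Sym n"
  shows "is_schubert n w (eq_schubert n w)" "eq_schubert n w \<in> carrier (HT n)"
proof -
  obtain p where p: "is_schubert n w p" using is_schubert_exists[OF w] by blast
  have gkm: "gkm n (restrict p (Sym n))"
    using p by (auto simp: is_schubert_def intro: gkm_cong)
  have "is_schubert n w (restrict p (Sym n))"
    using p w gkm unfolding is_schubert_def by simp
  then have "is_eq_schubert n w (restrict p (Sym n))"
    using w by (simp add: is_eq_schubert_iff)
  moreover have "q = restrict p (Sym n)" if "is_eq_schubert n w q" for q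
    using that calculation is_schubert_unique unfolding is_eq_schubert_iff[OF w]
    by (blast intro: extensionalityI)
  ultimately have "is_eq_schubert n w (eq_schubert n w)"
    unfolding eq_schubert_def by (rule theI)
  then show "is_schubert n w (eq_schubert n w)" "eq_schubert n w \<in> carrier (HT n)"
    using w by (simp_all add: is_eq_schubert_iff HT_carrier_iff is_schubert_def)
qed

theorem theorem4p1:
  fixes n i :: nat and w :: "nat \<Rightarrow> nat"
  assumes "n \<ge> 2" and "1 \<le> i" and "i \<le> n - 1" and "w \<in> Sym n"
  shows "schubert n (simple_refl i) \<otimes>\<^bsub>H n\<^esub> schubert n w =
    finsum (H n) (\<lambda>(j, k). schubert n (w \<circ> transpose j k))
      {(j, k). 1 \<le> j \<and> j \<le> i \<and> i + 1 \<le> k \<and> k \<le> n \<and>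
               len n (w \<circ> transpose j k) = len n w + 1}"
proof -
  let ?R = "HT n" and ?I = "aug_ideal n" and ?P = "eq_schubert n" and ?s = "simple_refl i"
  let ?z = "\<lambda>v\<in>Sym n. fund i w * ?P w v"
  define S where "S = {(j, k). 1 \<le> j \<and> j \<le> i \<and> i + 1 \<le> k \<and> k \<le> n \<and>
               len n (w \<circ> transpose j k) = len n w + 1}"
  define f where "f = (\<lambda>(j, k). ?P (w \<circ> transpose j k))"
  interpret I: ideal ?I ?R by (rule ideal_aug)
  interpret h: ring_hom_cring ?R "H n" "(+>\<^bsub>?R\<^esub>) ?I"
    unfolding H_def by (rule I.rcos_ring_hom_cring[OF cring_HT])
  have i: "1 \<le> i" "i < n" "i \<le> n" using assms by auto
  note w = assms(4)
  have s: "?s \<in> Sym n" using i by (intro Sym_transpose) auto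
  have finS: "finite S" by (rule finite_subset[of _ "{1..n} \<times> {1..n}"]) (auto simp: S_def)
  have f: "f x \<in> carrier ?R" if "x \<in> S" for x
    using that w i by (auto simp: S_def f_def intro!: eq_schubert(2) Sym_comp Sym_transpose)
  then have fS: "f \<in> S \<rightarrow> carrier ?R" by blast
  then have sumR: "finsum ?R f S \<in> carrier ?R" by (rule I.finsum_closed)
  have z: "?z \<in> ?I"
    using fund_mult_in_aug_ideal[OF w i(3)] HT_gkm[OF eq_schubert(2)[OF w]] by blast
  then have zR: "?z \<in> carrier ?R" by (rule I.Icarr)
  have "?P ?s \<otimes>\<^bsub>?R\<^esub> ?P w = ?z \<oplus>\<^bsub>?R\<^esub> finsum ?R f S"
  proof (rule HT_eqI)
    fix u assume u: "u \<in> Sym n"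
    have "?P ?s u = fund i u"
      by (rule is_schubert_simple[OF i(1,2) eq_schubert(1)[OF s] u])
    moreover have "fund i u * ?P w u = fund i w * ?P w u + (\<Sum>(j, k)\<in>S. ?P (w \<circ> transpose j k) u)"
      unfolding S_def by (rule equivariant_chevalley[OF i(1,2) w eq_schubert(1) u])
    moreover have "finsum ?R f S u = (\<Sum>x\<in>S. f x u)"
      using u by (simp add: finsum_HT[OF finS f])
    moreover have "\<dots> = (\<Sum>(j, k)\<in>S. ?P (w \<circ> transpose j k) u)"
      by (rule sum.cong) (auto simp: f_def)
    ultimately show "(?P ?s \<otimes>\<^bsub>?R\<^esub> ?P w) u = (?z \<oplus>\<^bsub>?R\<^esub> finsum ?R f S) u"
      using u by (simp only: HT_simps restrict_apply')
  qed (intro HT_mult_closed HT_add_closed eq_schubert(2) s w zR sumR)+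
  then have "schubert n ?s \<otimes>\<^bsub>H n\<^esub> schubert n w = (?I +>\<^bsub>?R\<^esub> ?z) \<oplus>\<^bsub>H n\<^esub> (?I +>\<^bsub>?R\<^esub> finsum ?R f S)"
    unfolding schubert_def
    by (simp only: h.hom_mult[symmetric] h.hom_add[symmetric] eq_schubert(2) s w zR sumR)
  \<comment> \<open>The coset of an element of the ideal is the ideal itself, which is the zero of
    the quotient ring.\<close>
  also have "?I +>\<^bsub>?R\<^esub> ?z = \<zero>\<^bsub>H n\<^esub>"
    unfolding I.a_rcos_const[OF z] H_def FactRing_def by (simp only: ring.select_convs)
  also have "?I +>\<^bsub>?R\<^esub> finsum ?R f S = finsum (H n) ((+>\<^bsub>?R\<^esub>) ?I \<circ> f) S"
    by (rule h.hom_finsum[OF fS])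
  also have "(+>\<^bsub>?R\<^esub>) ?I \<circ> f = (\<lambda>(j, k). schubert n (w \<circ> transpose j k))"
    by (auto simp: fun_eq_iff schubert_def f_def)
  also have "\<zero>\<^bsub>H n\<^esub> \<oplus>\<^bsub>H n\<^esub> finsum (H n) (\<lambda>(j, k). schubert n (w \<circ> transpose j k)) S =
      finsum (H n) (\<lambda>(j, k). schubert n (w \<circ> transpose j k)) S"
  proof (rule h.S.l_zero, rule h.S.finsum_closed)
    show "(\<lambda>(j, k). schubert n (w \<circ> transpose j k)) \<in> S \<rightarrow> carrier (H n)"
      using f by (auto simp: schubert_def f_def)
  qed
  finally show ?thesis unfolding S_def .
qed

end
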